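(* Let $p$ be an odd prime and let $d,\delta,k,k'$ be natural numbers with $k=k'$, $\delta-1\le k'$, $\delta\le d$ and $k\le\binom{\delta}{2}$. Let $r,t$ be non-negative integers with $\binom{\delta}{2}-k'=\binom{r}{2}+t$ and $0\le t<r$. Then there exists a capable finite $p$-group $H$ of nilpotency class two and exponent $p$ with $d(H)=d$, $d(H/Z(H))=\delta$, $d(\gamma_2H)=k'$ and $|\gamma_2H|=p^k$ (so $|H|=p^{n}$ with $n=d+k$) such that \[|M(H)|=p^{\frac{1}{2}(d-1)(n+k)-k(d-\delta)-\binom{\delta}{3}+\binom{r}{3}+\binom{t}{2}}.\]
   Context: A group $H$ is capable if there is a group $K$ with $H\cong K/Z(K)$. $d(\cdot)$ denotes the minimal number of generators, $Z(H)$ the center, $\gamma_2H$ the commutator subgroup, and $M(H)$ the Schur multiplier. Binomial coefficients satisfy $\binom{a}{b}=0$ when $0\le a<b$. *)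

theory Defs
  imports "HOL-Algebra.Algebra" Complex_Main
begin

definition group_center :: "('a, 'b) monoid_scheme \<Rightarrow> 'a set" where
  "group_center G = {z \<in> carrier G. \<forall>x \<in> carrier G. z \<otimes>\<^bsub>G\<^esub> x = x \<otimes>\<^bsub>G\<^esub> z}"

definition commutator_subgroup :: "('a, 'b) monoid_scheme \<Rightarrow> 'a set" where
  "commutator_subgroup G = derived G (carrier G)"

definition min_gens :: "('a, 'b) monoid_scheme \<Rightarrow> nat" where
  "min_gens G = (LEAST n. \<exists>S. S \<subseteq> carrier G \<and> finite S \<and> card S = n \<and> generate G S = carrier G)"

definition group_exponent :: "('a, 'b) monoid_scheme \<Rightarrow> nat" where
  "group_exponent G = (LEAST n. 0 < n \<and> (\<forall>x \<in> carrier G. x [^]\<^bsub>G\<^esub> n = \<one>\<^bsub>G\<^esub>))"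

definition nilpotent_class_two :: "('a, 'b) monoid_scheme \<Rightarrow> bool" where
  "nilpotent_class_two G \<longleftrightarrow> commutator_subgroup G \<noteq> {\<one>\<^bsub>G\<^esub>}
      \<and> commutator_subgroup G \<subseteq> group_center G"

text \<open>Capable: H \<cong> K/Z(K) for some group K. (A countable witness always suffices,
  so K is taken with carrier type nat.)\<close>
definition capable :: "('a, 'b) monoid_scheme \<Rightarrow> bool" where
  "capable H \<longleftrightarrow> (\<exists>K :: nat monoid. group K \<and> (K Mod group_center K) \<cong> H)"

text \<open>Schur multiplier M(G) = H^2(G, C^*): normalised-to-carrier 2-cocycles
  G x G -> C^* modulo 2-coboundaries.\<close>
definition cocycles2 :: "('a, 'b) monoid_scheme \<Rightarrow> ('a \<Rightarrow> 'a \<Rightarrow> complex) set" where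
  "cocycles2 G = {f.
      (\<forall>x \<in> carrier G. \<forall>y \<in> carrier G. f x y \<noteq> 0)
    \<and> (\<forall>x y. x \<notin> carrier G \<or> y \<notin> carrier G \<longrightarrow> f x y = 1)
    \<and> (\<forall>x \<in> carrier G. \<forall>y \<in> carrier G. \<forall>z \<in> carrier G.
         f x y * f (x \<otimes>\<^bsub>G\<^esub> y) z = f y z * f x (y \<otimes>\<^bsub>G\<^esub> z))}"

definition cohomologous :: "('a, 'b) monoid_scheme \<Rightarrow> (('a \<Rightarrow> 'a \<Rightarrow> complex) \<times> ('a \<Rightarrow> 'a \<Rightarrow> complex)) set" where
  "cohomologous G = {(f, g). f \<in> cocycles2 G \<and> g \<in> cocycles2 G \<and>
      (\<exists>c :: 'a \<Rightarrow> complex. (\<forall>x \<in> carrier G. c x \<noteq> 0) \<and>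
         (\<forall>x \<in> carrier G. \<forall>y \<in> carrier G. f x y = g x y * (c x * c y / c (x \<otimes>\<^bsub>G\<^esub> y))))}"

definition schur_multiplier :: "('a, 'b) monoid_scheme \<Rightarrow> ('a \<Rightarrow> 'a \<Rightarrow> complex) set set" where
  "schur_multiplier G = cocycles2 G // cohomologous G"

end

theory Submission
  imports Defs
begin

text \<open>Take the group of class two and exponent \<open>p\<close> on generators \<open>x\<^sub>0, \<dots>, x\<^bsub>d-1\<^esub>\<close> in which
  \<open>x\<^sub>i\<close> and \<open>x\<^sub>j\<close> (\<open>i < j\<close>) commute unless \<open>(i, j)\<close> lies in a set of \<open>k\<close> edges, and the commutators
  \<open>w\<^sub>i\<^sub>j\<close> over the edges are independent. The commuting pairs below \<open>\<delta>\<close> form an initial segment: all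
  pairs below \<open>r\<close>, together with \<open>t\<close> pairs \<open>(a, r)\<close>.

  For a 2-cocycle \<open>f\<close> and commuting \<open>u\<close>, \<open>v\<close> the quotient \<open>f u v / f v u\<close> is the commutator of lifts of
  \<open>u\<close> and \<open>v\<close> to the extension defined by \<open>f\<close>, and depends only on the class of \<open>f\<close>. The class is
  determined by these values at the commuting pairs \<open>(x\<^sub>i, x\<^sub>j)\<close> and at the pairs \<open>(w\<^sub>a\<^sub>b, x\<^sub>c)\<close> with
  \<open>a \<le> c < \<delta>\<close>: if all of them are 1, then by a Hall--Witt argument the commutators of lifts of the
  generators are central, and collection splits the extension. Conversely these values are arbitrary
  \<open>p\<close>-th roots of unity, since cup products and Massey products of the coordinate 1-cocycles form a
  dual basis; for the Massey products this uses that the edges are closed upwards. So the order of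
  the multiplier is \<open>p\<close> to the number of these pairs.

  The same cocycles define a central extension of the group by copies of the \<open>p\<close>-th roots of unity
  whose centre is the kernel, which gives capability.\<close>

section \<open>Collection in groups of class two\<close>

text \<open>The list fixes the order of the factors, which need not commute.\<close>

definition pow_prod :: "('a, 'b) monoid_scheme \<Rightarrow> ('i \<Rightarrow> 'a) \<Rightarrow> ('i \<Rightarrow> int) \<Rightarrow> 'i list \<Rightarrow> 'a" where
  "pow_prod G z g L = foldr (\<lambda>b a. z b [^]\<^bsub>G\<^esub> g b \<otimes>\<^bsub>G\<^esub> a) L \<one>\<^bsub>G\<^esub>"

lemma pow_prod_Nil [simp]: "pow_prod G z g [] = \<one>\<^bsub>G\<^esub>"
  and pow_prod_Cons [simp]:
    "pow_prod G z g (b # L) = z b [^]\<^bsub>G\<^esub> g b \<otimes>\<^bsub>G\<^esub> pow_prod G z g L"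
  by (simp_all add: pow_prod_def)

text \<open>The powers are compared rather than bases and exponents, so that an exponent may be
  changed modulo the order of its base, or at will where the base is not in the list.\<close>

lemma pow_prod_cong:
  "(\<And>b. b \<in> set L \<Longrightarrow> z b [^]\<^bsub>G\<^esub> g b = z' b [^]\<^bsub>G\<^esub> g' b) \<Longrightarrow> pow_prod G z g L = pow_prod G z' g' L"
  by (induction L) auto

lemma (in group) inv_mult_cancel:
  "a \<in> carrier G \<Longrightarrow> b \<in> carrier G \<Longrightarrow> inv a \<otimes> (a \<otimes> b) = b"
  by (simp add: m_assoc[symmetric])

lemma (in group) conjugation_hom: "w \<in> carrier G \<Longrightarrow> (\<lambda>x. inv w \<otimes> x \<otimes> w) \<in> hom G G"
proof (rule homI)
  fix u v assume "w \<in> carrier G" "u \<in> carrier G" "v \<in> carrier G"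
  then have "(inv w \<otimes> u \<otimes> w) \<otimes> (inv w \<otimes> v \<otimes> w) = inv w \<otimes> u \<otimes> (w \<otimes> inv w) \<otimes> v \<otimes> w"
    by (simp only: m_assoc m_closed inv_closed)
  then show "inv w \<otimes> (u \<otimes> v) \<otimes> w = (inv w \<otimes> u \<otimes> w) \<otimes> (inv w \<otimes> v \<otimes> w)"
    using \<open>w \<in> carrier G\<close> \<open>u \<in> carrier G\<close> \<open>v \<in> carrier G\<close> by (simp add: m_assoc)
qed auto

section \<open>Commuting elements, ordered products of powers and the exchange of powers\<close>

context group
begin

lemma commute_mult:
  assumes "u \<in> carrier G" "a \<in> carrier G" "b \<in> carrier G"
    and "u \<otimes> a = a \<otimes> u" "u \<otimes> b = b \<otimes> u"
  shows "u \<otimes> (a \<otimes> b) = (a \<otimes> b) \<otimes> u"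
  using assms by (metis m_assoc)

lemma commute_inv:
  assumes "u \<in> carrier G" "a \<in> carrier G" "u \<otimes> a = a \<otimes> u"
  shows "u \<otimes> inv a = inv a \<otimes> u"
  using assms by (metis inv_closed inv_solve_left inv_solve_right m_assoc m_closed)

lemma commute_int_pow:
  assumes "u \<in> carrier G" "a \<in> carrier G" "u \<otimes> a = a \<otimes> u"
  shows "u \<otimes> a [^] (n::int) = a [^] n \<otimes> u"
proof -
  have nat: "u \<otimes> a [^] (k::nat) = a [^] k \<otimes> u" for k
    using assms by (induction k) (auto intro: commute_mult)
  show ?thesis
    unfolding int_pow_def2 using nat assms by (simp only: split: if_split) (blast intro: commute_inv nat_pow_closed)
qed

lemma pow_prod_closed [simp, intro]:
  "(\<And>b. b \<in> set L \<Longrightarrow> z b \<in> carrier G) \<Longrightarrow> pow_prod G z g L \<in> carrier G"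
  by (induction L) auto

lemma pow_prod_commute:
  assumes "u \<in> carrier G" "\<And>b. b \<in> set L \<Longrightarrow> z b \<in> carrier G"
    and "\<And>b. b \<in> set L \<Longrightarrow> u \<otimes> z b = z b \<otimes> u"
  shows "u \<otimes> pow_prod G z g L = pow_prod G z g L \<otimes> u"
  using assms by (induction L) (auto intro!: commute_mult commute_int_pow)

lemma pow_prod_add:
  assumes "\<And>b. b \<in> set L \<Longrightarrow> z b \<in> carrier G"
    and "\<And>b c. b \<in> set L \<Longrightarrow> c \<in> set L \<Longrightarrow> z b \<otimes> z c = z c \<otimes> z b"
  shows "pow_prod G z (\<lambda>b. g b + h b) L = pow_prod G z g L \<otimes> pow_prod G z h L"
  using assms
proof (induction L)
  case (Cons b L)
  have c: "z b [^] h b \<otimes> pow_prod G z g L = pow_prod G z g L \<otimes> z b [^] h b"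
    using Cons.prems by (intro pow_prod_commute) (auto intro!: commute_int_pow commute_int_pow[symmetric])
  have cl: "z b \<in> carrier G" "pow_prod G z g L \<in> carrier G" "pow_prod G z h L \<in> carrier G"
    using Cons.prems by auto
  have "pow_prod G z (\<lambda>b. g b + h b) (b # L)
      = z b [^] g b \<otimes> (z b [^] h b \<otimes> pow_prod G z g L) \<otimes> pow_prod G z h L"
    using Cons cl by (simp add: int_pow_mult m_assoc)
  also have "\<dots> = pow_prod G z g (b # L) \<otimes> pow_prod G z h (b # L)"
    unfolding c using cl by (simp add: m_assoc)
  finally show ?case .
qed auto

lemma pow_prod_zero [simp]: "pow_prod G z (\<lambda>b. 0) L = \<one>"
  by (induction L) auto

lemma pow_prod_single:
  assumes "distinct L" "\<And>b. b \<in> set L \<Longrightarrow> z b \<in> carrier G"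
  shows "pow_prod G z (\<lambda>b. if b = c then k else 0) L = (if c \<in> set L then z c [^] k else \<one>)"
  using assms
proof (induction L)
  case (Cons b L)
  show ?case
  proof (cases "b = c")
    case True
    then have "pow_prod G z (\<lambda>b. if b = c then k else 0) L = pow_prod G z (\<lambda>b. 0) L"
      using Cons.prems by (intro pow_prod_cong) auto
    then show ?thesis using Cons True by simp
  qed (use Cons in auto)
qed auto

lemma int_pow_mod:
  assumes "x \<in> carrier G" "x [^] (n::nat) = \<one>"
  shows "x [^] (a mod int n) = x [^] (a::int)"
proof -
  have "x [^] a = x [^] (int n * (a div int n) + a mod int n)" by simp
  also have "\<dots> = (x [^] int n) [^] (a div int n) \<otimes> x [^] (a mod int n)"
    unfolding int_pow_mult[OF assms(1)] int_pow_pow[OF assms(1)] by (rule refl)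
  also have "\<dots> = x [^] (a mod int n)" using assms by (simp add: int_pow_int)
  finally show ?thesis by simp
qed

text \<open>Conjugation by \<open>a\<close> is a homomorphism that sends \<open>b\<close> to
  \<open>b \<otimes> c\<close>, hence \<open>b [^] m\<close> to the \<open>m\<close>-th power of
  that product. Only \<open>b\<close> has to commute with \<open>c\<close> here; the case
  \<open>b [^] m = \<one>\<close> later bounds the order of \<open>c\<close>.\<close>

lemma int_pow_exchange_one:
  assumes "a \<in> carrier G" "b \<in> carrier G" "c \<in> carrier G"
    and "b \<otimes> a = a \<otimes> b \<otimes> c" and "b \<otimes> c = c \<otimes> b"
  shows "b [^] (m::int) \<otimes> a = a \<otimes> b [^] m \<otimes> c [^] m"
proof -
  interpret h: group_hom G G "\<lambda>x. inv a \<otimes> x \<otimes> a"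
    using conjugation_hom[OF assms(1)] by unfold_locales
  have "inv a \<otimes> b [^] m \<otimes> a = (inv a \<otimes> b \<otimes> a) [^] m"
    using h.hom_int_pow[OF assms(2), of m] .
  also have "inv a \<otimes> b \<otimes> a = b \<otimes> c"
    using assms by (simp add: m_assoc inv_solve_left')
  also have "(b \<otimes> c) [^] m = b [^] m \<otimes> c [^] m"
    using assms by (intro int_pow_mult_distrib) auto
  finally have e: "inv a \<otimes> b [^] m \<otimes> a = b [^] m \<otimes> c [^] m" .
  have "b [^] m \<otimes> a = a \<otimes> (inv a \<otimes> b [^] m \<otimes> a)"
    using assms by (simp add: m_assoc[symmetric])
  then show ?thesis unfolding e using assms by (simp add: m_assoc)
qed

lemma int_pow_exchange:
  assumes "a \<in> carrier G" "b \<in> carrier G" "c \<in> carrier G"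
    and "b \<otimes> a = a \<otimes> b \<otimes> c" and ac: "a \<otimes> c = c \<otimes> a" and bc: "b \<otimes> c = c \<otimes> b"
  shows "b [^] (m::int) \<otimes> a [^] (n::int) = a [^] n \<otimes> b [^] m \<otimes> c [^] (m * n)"
proof -
  let ?B = "b [^] m" and ?C = "c [^] m"
  have cl: "?B \<in> carrier G" "?C \<in> carrier G" "inv ?C \<in> carrier G" using assms by auto
  have 1: "?B \<otimes> a = a \<otimes> ?B \<otimes> ?C"
    using assms by (intro int_pow_exchange_one) auto
  have aC: "a \<otimes> ?C = ?C \<otimes> a" and BC: "?B \<otimes> ?C = ?C \<otimes> ?B"
    using assms by (auto intro!: commute_int_pow commute_int_pow[symmetric])
  \<comment> \<open>Solved for \<open>a \<otimes> ?B\<close>, the relation has the same shape with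
    \<open>a\<close> and \<open>?B\<close> exchanged and commutator \<open>inv ?C\<close>, so the
    one-sided exchange applies again and moves \<open>?B\<close> past
    \<open>a [^] n\<close>.\<close>
  have 2: "a \<otimes> ?B = ?B \<otimes> a \<otimes> inv ?C"
    using 1 cl assms(1) by (simp add: inv_solve_right)
  have "a [^] n \<otimes> ?B = ?B \<otimes> a [^] n \<otimes> inv ?C [^] n"
    using 2 cl assms(1) aC by (intro int_pow_exchange_one) (auto intro: commute_inv)
  moreover have "inv ?C [^] n = inv (?C [^] n)" using cl by (simp add: int_pow_inv)
  ultimately have "a [^] n \<otimes> ?B \<otimes> ?C [^] n = ?B \<otimes> a [^] n"
    using cl assms(1) by (simp add: m_assoc)
  then show ?thesis using assms by (simp add: int_pow_pow)
qed

end

text \<open>The commutation relations between the \<open>y e\<close> and the \<open>x i\<close> make the subgroup generated by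
  them class two; \<open>collect\<close> is Hall's collection process there.\<close>

locale collecting = group G for G (structure) +
  fixes x :: "nat \<Rightarrow> 'a" and y :: "nat \<times> nat \<Rightarrow> 'a" and d :: nat and Es :: "(nat \<times> nat) list"
  assumes distinct_Es: "distinct Es"
    and Es_less: "\<And>i j. (i, j) \<in> set Es \<Longrightarrow> i < j \<and> j < d"
    and x_closed [simp]: "\<And>i. i < d \<Longrightarrow> x i \<in> carrier G"
    and y_closed [simp]: "\<And>e. e \<in> set Es \<Longrightarrow> y e \<in> carrier G"
    and yx: "\<And>e i. e \<in> set Es \<Longrightarrow> i < d \<Longrightarrow> y e \<otimes> x i = x i \<otimes> y e"
    and yy: "\<And>e e'. e \<in> set Es \<Longrightarrow> e' \<in> set Es \<Longrightarrow> y e \<otimes> y e' = y e' \<otimes> y e"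
    and xx: "\<And>i j. i < j \<Longrightarrow> j < d \<Longrightarrow>
      x j \<otimes> x i = (if (i, j) \<in> set Es then x i \<otimes> x j \<otimes> y (i, j) else x i \<otimes> x j)"
begin

abbreviation "xprod v L \<equiv> pow_prod G x v L"
abbreviation "yprod w \<equiv> pow_prod G y w Es"

lemma yprod_closed [simp]: "yprod w \<in> carrier G"
  by auto

lemma xprod_closed: "set L \<subseteq> {..<d} \<Longrightarrow> xprod v L \<in> carrier G"
  by (rule pow_prod_closed) auto

lemma yprod_add: "yprod (\<lambda>e. w e + w' e) = yprod w \<otimes> yprod w'"
  by (rule pow_prod_add) (auto intro: yy)

lemma yprod_x: "i < d \<Longrightarrow> x i [^] (n::int) \<otimes> yprod w = yprod w \<otimes> x i [^] n"
  by (rule pow_prod_commute) (auto intro!: commute_int_pow[symmetric] yx)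

lemma yprod_x1: "i < d \<Longrightarrow> yprod w \<otimes> x i = x i \<otimes> yprod w"
  using yprod_x[of i 1] by (metis int_pow_1 x_closed)

lemma yprod_xprod: "set L \<subseteq> {..<d} \<Longrightarrow> yprod w \<otimes> xprod v L = xprod v L \<otimes> yprod w"
  by (rule pow_prod_commute) (auto simp: yprod_x1)

text \<open>The commutator is written as a \<open>yprod\<close> supported at one pair. It is trivial
  if that pair is no edge, so edges and commuting pairs need no separate treatment later.\<close>

lemma x_exchange:
  assumes "i < j" "j < d"
  shows "x j [^] (m::int) \<otimes> x i [^] (n::int)
    = x i [^] n \<otimes> x j [^] m \<otimes> yprod (\<lambda>e. if e = (i, j) then m * n else 0)"
proof (cases "(i, j) \<in> set Es")
  case True
  have "x j [^] m \<otimes> x i [^] n = x i [^] n \<otimes> x j [^] m \<otimes> y (i, j) [^] (m * n)"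
    using assms True by (intro int_pow_exchange) (auto simp: xx yx)
  then show ?thesis using True distinct_Es by (simp add: pow_prod_single)
next
  case False
  have "x j [^] m \<otimes> x i [^] n = x i [^] n \<otimes> x j [^] m \<otimes> \<one> [^] (m * n)"
    using assms False by (intro int_pow_exchange) (auto simp: xx)
  then show ?thesis using False distinct_Es assms by (simp add: pow_prod_single)
qed

lemma xprod_exchange:
  assumes "set L \<subseteq> {i<..<d}" "i < d" "distinct L"
  shows "xprod v L \<otimes> x i [^] (n::int)
    = x i [^] n \<otimes> xprod v L \<otimes> yprod (\<lambda>(k, j). if k = i \<and> j \<in> set L then v j * n else 0)"
  using assms
proof (induction L)
  case Nil
  have "yprod (\<lambda>(k, j). 0) = \<one>" by (simp add: case_prod_unfold)
  then show ?case by (simp add: assms)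
next
  case (Cons j L)
  let ?w = "\<lambda>(k, j). if k = i \<and> j \<in> set L then v j * n else 0"
  let ?w1 = "\<lambda>e. if e = (i, j) then v j * n else 0"
  have j: "i < j" "j < d" "set L \<subseteq> {..<d}" using Cons.prems by auto
  have cl: "x i \<in> carrier G" "x j \<in> carrier G" "xprod v L \<in> carrier G"
    using Cons.prems j by (auto simp: xprod_closed)
  have "xprod v (j # L) \<otimes> x i [^] n = x j [^] v j \<otimes> (x i [^] n \<otimes> xprod v L \<otimes> yprod ?w)"
    using cl Cons.IH[OF _ Cons.prems(2)] Cons.prems(1,3) by (simp add: m_assoc del: pow_prod_closed)
  also have "\<dots> = (x j [^] v j \<otimes> x i [^] n) \<otimes> xprod v L \<otimes> yprod ?w"
    using cl by (simp add: m_assoc)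
  also have "\<dots> = x i [^] n \<otimes> x j [^] v j \<otimes> (yprod ?w1 \<otimes> xprod v L) \<otimes> yprod ?w"
    unfolding x_exchange[OF j(1,2)] using cl by (simp add: m_assoc)
  also have "\<dots> = x i [^] n \<otimes> xprod v (j # L) \<otimes> (yprod ?w1 \<otimes> yprod ?w)"
    unfolding yprod_xprod[OF j(3)] using cl by (simp add: m_assoc)
  also have "yprod ?w1 \<otimes> yprod ?w = yprod (\<lambda>e. ?w1 e + ?w e)" by (simp add: yprod_add)
  also have "(\<lambda>e. ?w1 e + ?w e) = (\<lambda>(k, l). if k = i \<and> l \<in> set (j # L) then v l * n else 0)"
    using Cons.prems by (auto simp: fun_eq_iff)
  finally show ?case .
qed

lemma collect:
  assumes "sorted_wrt (<) L" "set L \<subseteq> {..<d}"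
  shows "xprod v L \<otimes> xprod v' L = xprod (\<lambda>i. v i + v' i) L
    \<otimes> yprod (\<lambda>(i, j). if i \<in> set L \<and> j \<in> set L then v j * v' i else 0)"
  using assms
proof (induction L)
  case Nil
  have "yprod (\<lambda>(k, j). 0) = \<one>" by (simp add: case_prod_unfold)
  then show ?case by simp
next
  case (Cons i L)
  let ?w = "\<lambda>(i, j). if i \<in> set L \<and> j \<in> set L then v j * v' i else 0"
  let ?w1 = "\<lambda>(k, j). if k = i \<and> j \<in> set L then v j * v' i else 0"
  let ?w2 = "\<lambda>(k, j). if k \<in> set (i # L) \<and> j \<in> set (i # L) then v j * v' k else 0"
  have i: "i < d" "set L \<subseteq> {..<d}" "set L \<subseteq> {i<..<d}" "distinct L"
    using Cons.prems by (auto simp: strict_sorted_iff)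
  have cl: "x i \<in> carrier G" "xprod v L \<in> carrier G" "xprod v' L \<in> carrier G"
      "xprod (\<lambda>i. v i + v' i) L \<in> carrier G" using i by (auto simp: xprod_closed)
  have "xprod v (i # L) \<otimes> xprod v' (i # L)
     = x i [^] v i \<otimes> (xprod v L \<otimes> x i [^] v' i) \<otimes> xprod v' L"
    using cl by (simp add: m_assoc)
  also have "\<dots> = x i [^] v i \<otimes> x i [^] v' i \<otimes> xprod v L \<otimes> (yprod ?w1 \<otimes> xprod v' L)"
    unfolding xprod_exchange[OF i(3,1,4)] using cl by (simp add: m_assoc)
  also have "\<dots> = (x i [^] v i \<otimes> x i [^] v' i) \<otimes> (xprod v L \<otimes> xprod v' L) \<otimes> yprod ?w1"
    unfolding yprod_xprod[OF i(2)] using cl by (simp add: m_assoc)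
  also have "\<dots> = xprod (\<lambda>i. v i + v' i) (i # L) \<otimes> (yprod ?w \<otimes> yprod ?w1)"
    using Cons i cl by (simp add: int_pow_mult m_assoc)
  also have "yprod ?w \<otimes> yprod ?w1 = yprod (\<lambda>e. ?w e + ?w1 e)" by (simp add: yprod_add)
  also have "\<dots> = yprod ?w2"
  \<comment> \<open>\<open>?w2\<close> also has entries at the pairs \<open>(k, i)\<close> with
    \<open>k\<close> in \<open>i # L\<close>. These are not edges, because \<open>i\<close> is the
    least entry and edges increase.\<close>
  proof (rule pow_prod_cong)
    fix e assume "e \<in> set Es"
    moreover obtain k j where "e = (k, j)" by force
    ultimately have "?w e + ?w1 e = ?w2 e" using Es_less[of k j] i by auto
    then show "y e [^] (?w e + ?w1 e) = y e [^] ?w2 e" by simp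
  qed
  finally show ?case .
qed

end

section \<open>Numbers of generators, capability and central extensions\<close>

text \<open>Adjoining a generator \<open>s\<close> multiplies the order by at most \<open>p\<close>:
  each new element is a power of \<open>s\<close>, with exponent reduced modulo \<open>p\<close>,
  times an element of the old subgroup.\<close>

lemma (in comm_group) card_generate_le:
  fixes p :: nat
  assumes "finite S" "S \<subseteq> carrier G" and p: "p > 0"
    and exp: "\<And>x. x \<in> carrier G \<Longrightarrow> x [^] p = \<one>"
  shows "finite (generate G S) \<and> card (generate G S) \<le> p ^ card S"
  using assms(1,2)
proof (induction S)
  case empty
  then show ?case by (simp add: generate_empty)
next
  case (insert s S)
  have s: "s \<in> carrier G" and S: "S \<subseteq> carrier G" using insert.prems by auto
  have gS: "g \<in> generate G S \<Longrightarrow> g \<in> carrier G" for g using generate_in_carrier[OF S] .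
  let ?f = "\<lambda>(a, g). s [^] (a::int) \<otimes> g"
  have "x \<in> ?f ` (UNIV \<times> generate G S)" if "x \<in> generate G (insert s S)" for x
    using that
  proof induction
    case one
    have "?f (0, \<one>) = \<one>" by simp
    then show ?case by (metis SigmaI UNIV_I generate.one image_eqI)
  next
    case (incl h)
    have "?f (1, \<one>) = s" "h \<in> carrier G \<Longrightarrow> ?f (0, h) = h" using s by auto
    then show ?case using incl S generate.incl[of _ S G] generate.one[of G S]
      by (smt (verit) SigmaI UNIV_I image_eqI insertE insert.prems subset_eq)
  next
    case (inv h)
    have "?f (-1, \<one>) = inv s" "h \<in> carrier G \<Longrightarrow> ?f (0, inv h) = inv h"
      using s by (auto simp: int_pow_neg)
    then show ?case using inv S generate.inv[of _ S G] generate.one[of G S]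
      by (smt (verit) SigmaI UNIV_I image_eqI insertE insert.prems subset_eq)
  next
    case (eng h1 h2)
    then obtain a1 g1 a2 g2 where h: "h1 = ?f (a1, g1)" "h2 = ?f (a2, g2)"
      "g1 \<in> generate G S" "g2 \<in> generate G S" by auto
    have "h1 \<otimes> h2 = ?f (a1 + a2, g1 \<otimes> g2)"
      using h gS s by (simp add: int_pow_mult m_ac)
    then show ?case using generate.eng[OF h(3,4)] by blast
  qed
  moreover have "?f (a, g) = ?f (a mod int p, g)" for a g
    using int_pow_mod[OF s exp[OF s]] by simp
  moreover have "a mod int p \<in> {0..<int p}" for a using p by simp
  ultimately have sub: "generate G (insert s S) \<subseteq> ?f ` ({0..<int p} \<times> generate G S)"
    by (smt (verit, ccfv_threshold) SigmaE SigmaI image_iff subsetI)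
  have fin: "finite ({0..<int p} \<times> generate G S)" using insert.IH S by auto
  have "card (generate G (insert s S)) \<le> card (?f ` ({0..<int p} \<times> generate G S))"
    using sub fin by (intro card_mono) auto
  also have "\<dots> \<le> card ({0..<int p} \<times> generate G S)" using fin by (rule card_image_le)
  also have "\<dots> \<le> p * p ^ card S" using insert.IH S by (simp add: card_cartesian_product)
  finally show ?case using sub fin insert.hyps finite_subset by fastforce
qed

text \<open>A generating set maps onto one of the elementary abelian image, and
  \<open>card S\<close> elements generate at most \<open>p ^ card S\<close> elements there.\<close>

lemma (in group_hom) card_generators_ge:
  fixes p n :: nat
  assumes "comm_group H" "1 < p" "\<And>x. x \<in> carrier H \<Longrightarrow> x [^]\<^bsub>H\<^esub> p = \<one>\<^bsub>H\<^esub>"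
    and "card (carrier H) = p ^ n" "h ` carrier G = carrier H"
    and "S \<subseteq> carrier G" "finite S" "generate G S = carrier G"
  shows "n \<le> card S"
proof -
  interpret H: comm_group H by fact
  have "generate H (h ` S) = carrier H" using generate_img[OF assms(6)] assms by simp
  moreover have "card (generate H (h ` S)) \<le> p ^ card (h ` S)"
    using H.card_generate_le[of "h ` S" p] assms by auto
  ultimately have "p ^ n \<le> p ^ card (h ` S)" using assms by simp
  then have "n \<le> card (h ` S)" using assms by simp
  also have "\<dots> \<le> card S" using assms(7) by (rule card_image_le)
  finally show ?thesis .
qed

lemma min_gens_eqI:
  assumes "S \<subseteq> carrier G" "finite S" "generate G S = carrier G" "card S \<le> n"
    and "\<And>T. T \<subseteq> carrier G \<Longrightarrow> finite T \<Longrightarrow> generate G T = carrier G \<Longrightarrow> n \<le> card T"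
  shows "min_gens G = n"
  unfolding min_gens_def
  using assms by (intro Least_equality) (blast intro: antisym)+

section \<open>Capability from an epimorphism whose kernel is the centre\<close>

lemma group_center_iso:
  assumes \<phi>: "\<phi> \<in> iso G K" "group G" "group K"
  shows "group_center K = \<phi> ` group_center G"
proof -
  interpret group_hom G K \<phi>
    using assms by (simp add: group_hom_def group_hom_axioms_def iso_imp_homomorphism)
  have im: "carrier K = \<phi> ` carrier G" and inj: "inj_on \<phi> (carrier G)"
    using \<phi> by (auto simp: iso_def bij_betw_def)
  have comm: "\<phi> a \<otimes>\<^bsub>K\<^esub> \<phi> b = \<phi> b \<otimes>\<^bsub>K\<^esub> \<phi> a \<longleftrightarrow> a \<otimes>\<^bsub>G\<^esub> b = b \<otimes>\<^bsub>G\<^esub> a"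
    if "a \<in> carrier G" "b \<in> carrier G" for a b
    using that inj by (metis G.m_closed hom_mult inj_on_def)
  show ?thesis
    unfolding group_center_def im using comm by auto
qed

lemma capableI:
  fixes K :: "('k, 'x) monoid_scheme"
  assumes "group_hom K H \<psi>" "finite (carrier K)" "\<psi> ` carrier K = carrier H"
    and ker: "kernel K H \<psi> = group_center K"
  shows "capable H"
proof -
  interpret \<psi>: group_hom K H \<psi> by fact
  obtain \<phi> :: "'k \<Rightarrow> nat" where inj: "inj_on \<phi> (carrier K)"
    using finite_imp_inj_to_nat_seg[OF assms(2)] by blast
  define N where "N = image_group \<phi> K"
  have N: "group N" unfolding N_def by (rule \<psi>.G.inj_imp_image_group_is_group[OF inj])
  have \<phi>: "\<phi> \<in> iso K N" unfolding N_def by (rule inj_imp_image_group_iso[OF inj])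
  define \<chi> where "\<chi> = inv_into (carrier K) \<phi>"
  have "\<chi> \<in> iso N K" using \<psi>.G.iso_set_sym[OF \<phi>] by (simp add: \<chi>_def)
  then interpret \<chi>: group_hom N K \<chi>
    using N by (simp add: group_hom_def group_hom_axioms_def iso_imp_homomorphism)
  interpret g: group_hom N H "\<psi> \<circ> \<chi>"
    by unfold_locales (auto simp: hom_def)
  have cN: "carrier N = \<phi> ` carrier K" using \<phi> by (auto simp: iso_def bij_betw_def)
  have inv: "x \<in> carrier K \<Longrightarrow> \<chi> (\<phi> x) = x" for x using inj by (simp add: \<chi>_def)
  have "kernel N H (\<psi> \<circ> \<chi>) = \<phi> ` kernel K H \<psi>"
    unfolding kernel_def cN using inv by auto
  also have "\<dots> = group_center N" using group_center_iso[OF \<phi>] N ker by simp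
  finally have k: "kernel N H (\<psi> \<circ> \<chi>) = group_center N" .
  have "(\<psi> \<circ> \<chi>) ` carrier N = carrier H" unfolding cN assms(3)[symmetric] using inv
    by (force simp: image_iff)
  from g.FactGroup_iso[OF this] k show ?thesis unfolding capable_def using N by metis
qed

text \<open>Only normalised cocycles are used, so that the unit is the pair of units.\<close>

definition central_ext ::
    "('c, 'e) monoid_scheme \<Rightarrow> ('a, 'b) monoid_scheme \<Rightarrow> ('a \<Rightarrow> 'a \<Rightarrow> 'c) \<Rightarrow> ('c \<times> 'a) monoid" where
  "central_ext A G f = \<lparr>carrier = carrier A \<times> carrier G,
     monoid.mult = (\<lambda>(a, x) (b, y). (a \<otimes>\<^bsub>A\<^esub> b \<otimes>\<^bsub>A\<^esub> f x y, x \<otimes>\<^bsub>G\<^esub> y)),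
     one = (\<one>\<^bsub>A\<^esub>, \<one>\<^bsub>G\<^esub>)\<rparr>"

section \<open>The extension of a group by an abelian group along a normalised cocycle\<close>

locale central_extension = A: comm_group A + G: group G for A (structure) and G (structure) +
  fixes f
  assumes f_closed: "\<And>x y. x \<in> carrier G \<Longrightarrow> y \<in> carrier G \<Longrightarrow> f x y \<in> carrier A"
    and f_cocycle: "\<And>x y z. x \<in> carrier G \<Longrightarrow> y \<in> carrier G \<Longrightarrow> z \<in> carrier G \<Longrightarrow>
      f x y \<otimes>\<^bsub>A\<^esub> f (x \<otimes>\<^bsub>G\<^esub> y) z = f y z \<otimes>\<^bsub>A\<^esub> f x (y \<otimes>\<^bsub>G\<^esub> z)"
    and f_one_left: "\<And>x. x \<in> carrier G \<Longrightarrow> f \<one>\<^bsub>G\<^esub> x = \<one>\<^bsub>A\<^esub>"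
    and f_one_right: "\<And>x. x \<in> carrier G \<Longrightarrow> f x \<one>\<^bsub>G\<^esub> = \<one>\<^bsub>A\<^esub>"
begin

abbreviation "Ext \<equiv> central_ext A G f"

lemma Ext_carrier: "carrier Ext = carrier A \<times> carrier G"
  and Ext_mult: "(a, x) \<otimes>\<^bsub>Ext\<^esub> (b, y) = (a \<otimes>\<^bsub>A\<^esub> b \<otimes>\<^bsub>A\<^esub> f x y, x \<otimes>\<^bsub>G\<^esub> y)"
  and Ext_one: "\<one>\<^bsub>Ext\<^esub> = (\<one>\<^bsub>A\<^esub>, \<one>\<^bsub>G\<^esub>)"
  by (auto simp: central_ext_def)

lemma group_Ext: "group Ext"
proof (rule groupI)
  fix u v w assume "u \<in> carrier Ext" "v \<in> carrier Ext" "w \<in> carrier Ext"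
  then obtain a x b y c z where e: "u = (a, x)" "v = (b, y)" "w = (c, z)"
    and cl: "a \<in> carrier A" "b \<in> carrier A" "c \<in> carrier A"
      "x \<in> carrier G" "y \<in> carrier G" "z \<in> carrier G"
    by (auto simp: Ext_carrier)
  have "a \<otimes>\<^bsub>A\<^esub> b \<otimes>\<^bsub>A\<^esub> f x y \<otimes>\<^bsub>A\<^esub> c \<otimes>\<^bsub>A\<^esub> f (x \<otimes>\<^bsub>G\<^esub> y) z
     = a \<otimes>\<^bsub>A\<^esub> b \<otimes>\<^bsub>A\<^esub> c \<otimes>\<^bsub>A\<^esub> (f x y \<otimes>\<^bsub>A\<^esub> f (x \<otimes>\<^bsub>G\<^esub> y) z)"
    using cl f_closed by (simp add: A.m_ac)
  also have "\<dots> = a \<otimes>\<^bsub>A\<^esub> (b \<otimes>\<^bsub>A\<^esub> c \<otimes>\<^bsub>A\<^esub> f y z) \<otimes>\<^bsub>A\<^esub> f x (y \<otimes>\<^bsub>G\<^esub> z)"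
    using cl f_closed by (simp add: A.m_ac f_cocycle)
  finally show "u \<otimes>\<^bsub>Ext\<^esub> v \<otimes>\<^bsub>Ext\<^esub> w = u \<otimes>\<^bsub>Ext\<^esub> (v \<otimes>\<^bsub>Ext\<^esub> w)"
    using cl by (simp add: e Ext_mult G.m_assoc)
next
  fix u assume "u \<in> carrier Ext"
  then obtain a x where e: "u = (a, x)" and cl: "a \<in> carrier A" "x \<in> carrier G"
    by (auto simp: Ext_carrier)
  show "\<one>\<^bsub>Ext\<^esub> \<otimes>\<^bsub>Ext\<^esub> u = u" using cl by (simp add: e Ext_mult Ext_one f_one_left)
  let ?v = "(inv\<^bsub>A\<^esub> (a \<otimes>\<^bsub>A\<^esub> f (inv\<^bsub>G\<^esub> x) x), inv\<^bsub>G\<^esub> x)"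
  have fc: "f (inv\<^bsub>G\<^esub> x) x \<in> carrier A" using cl f_closed by simp
  then have "inv\<^bsub>A\<^esub> (a \<otimes>\<^bsub>A\<^esub> f (inv\<^bsub>G\<^esub> x) x) \<otimes>\<^bsub>A\<^esub> a \<otimes>\<^bsub>A\<^esub> f (inv\<^bsub>G\<^esub> x) x = \<one>\<^bsub>A\<^esub>"
    using cl by (simp add: A.m_assoc)
  then show "\<exists>v\<in>carrier Ext. v \<otimes>\<^bsub>Ext\<^esub> u = \<one>\<^bsub>Ext\<^esub>"
    using cl fc by (intro bexI[of _ ?v]) (auto simp: e Ext_mult Ext_one Ext_carrier)
qed (auto simp: Ext_carrier Ext_one Ext_mult f_closed)

text \<open>Used in both directions: to make lifts of generators commute when an extension is split,
  and to read the centre of the extension for capability off its cocycle.\<close>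

lemma Ext_commute_iff:
  assumes "a \<in> carrier A" "b \<in> carrier A" "x \<in> carrier G" "y \<in> carrier G"
  shows "(a, x) \<otimes>\<^bsub>Ext\<^esub> (b, y) = (b, y) \<otimes>\<^bsub>Ext\<^esub> (a, x) \<longleftrightarrow> x \<otimes>\<^bsub>G\<^esub> y = y \<otimes>\<^bsub>G\<^esub> x \<and> f x y = f y x"
  using assms f_closed by (auto simp: Ext_mult A.m_comm[of b a])

lemma snd_hom: "group_hom Ext G snd"
  using group_Ext G.is_group
  by (auto simp: group_hom_def group_hom_axioms_def hom_def Ext_carrier Ext_mult)

end

section \<open>The group of a shifted graph\<close>

lemma card_bounded_functions:
  fixes p :: nat
  assumes "finite S" "0 < p"
  shows "card {g :: 'i \<Rightarrow> int. (\<forall>b\<in>S. 0 \<le> g b \<and> g b < int p) \<and> (\<forall>b. b \<notin> S \<longrightarrow> g b = 0)} = p ^ card S"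
    (is "card ?T = _")
proof -
  have "bij_betw (\<lambda>g. restrict g S) ?T (S \<rightarrow>\<^sub>E {0..<int p})"
    by (rule bij_betw_byWitness[where f' = "\<lambda>g b. if b \<in> S then g b else 0"])
      (auto simp: fun_eq_iff PiE_iff extensional_def)
  then have "card ?T = card (S \<rightarrow>\<^sub>E {0..<int p})" by (rule bij_betw_same_card)
  also have "\<dots> = p ^ card S" using assms by (simp add: card_PiE)
  finally show ?thesis .
qed

lemma (in group) subgroup_pow_prod:
  assumes "subgroup U G" "\<And>b. b \<in> set L \<Longrightarrow> z b \<in> U"
  shows "pow_prod G z g L \<in> U"
  using assms
  by (induction L) (auto intro: subgroup_int_pow_closed subgroup.m_closed subgroup.one_closed)

text \<open>A tuple stores the exponent of the \<open>i\<close>-th generator at the diagonal pair \<open>(i, i)\<close>, and the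
  exponent of the commutator of the \<open>j\<close>-th and the \<open>i\<close>-th generator at the edge \<open>(i, j)\<close>.\<close>

definition indices :: "nat \<Rightarrow> (nat \<times> nat) set \<Rightarrow> (nat \<times> nat) set" where
  "indices d E = (\<lambda>i. (i, i)) ` {..<d} \<union> E"

text \<open>The product is what collection yields: at an edge \<open>(i, j)\<close>, moving the
  \<open>j\<close>-th generator of \<open>g\<close> to the right past the \<open>i\<close>-th
  generator of \<open>h\<close> contributes the product of their exponents.\<close>

definition graph_group :: "nat \<Rightarrow> nat \<Rightarrow> (nat \<times> nat) set \<Rightarrow> (nat \<times> nat \<Rightarrow> int) monoid" where
  "graph_group p d E =
     \<lparr>carrier = {g. (\<forall>b\<in>indices d E. 0 \<le> g b \<and> g b < int p) \<and> (\<forall>b. b \<notin> indices d E \<longrightarrow> g b = 0)},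
      monoid.mult = (\<lambda>g h (i, j). if (i, j) \<in> indices d E
        then (g (i, j) + h (i, j) + (if i < j then g (j, j) * h (i, i) else 0)) mod int p else 0),
      one = (\<lambda>_. 0)\<rparr>"

text \<open>Edges join generators that do \<^emph>\<open>not\<close> commute. By \<open>E_top\<close> and \<open>E_up\<close> the vertex \<open>\<delta> - 1\<close> is
  joined to all others below \<open>\<delta>\<close>, so that no generator below \<open>\<delta>\<close> is central.\<close>

locale shifted_graph =
  fixes p d \<delta> :: nat and E :: "(nat \<times> nat) set"
  assumes prime_p: "Factorial_Ring.prime p" and odd_p: "odd p"
    and \<delta>_ge: "2 \<le> \<delta>" and \<delta>_le: "\<delta> \<le> d"
    and E_less: "\<And>i j. (i, j) \<in> E \<Longrightarrow> i < j \<and> j < \<delta>"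
    and E_up: "\<And>a b a' b'. (a, b) \<in> E \<Longrightarrow> a \<le> a' \<Longrightarrow> b \<le> b' \<Longrightarrow> a' < b' \<Longrightarrow> b' < \<delta> \<Longrightarrow> (a', b') \<in> E"
    and E_top: "(0, \<delta> - 1) \<in> E"
begin

abbreviation "B \<equiv> indices d E"
abbreviation "T \<equiv> graph_group p d E"

lemma p_gt1: "1 < p" using prime_p prime_gt_1_nat by blast

lemma diag_B [simp]: "(i, i) \<in> B \<longleftrightarrow> i < d"
  by (auto simp: indices_def dest: E_less)

lemma edge_B [simp]: "i \<noteq> j \<Longrightarrow> (i, j) \<in> B \<longleftrightarrow> (i, j) \<in> E"
  by (auto simp: indices_def)

lemma E_less_d: "(i, j) \<in> E \<Longrightarrow> i < d \<and> j < d"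
  using E_less \<delta>_le by fastforce

lemma finite_E: "finite E"
  by (rule finite_subset[of _ "{..<\<delta>} \<times> {..<\<delta>}"]) (auto dest: E_less)

lemma finite_B: "finite B" using finite_E by (simp add: indices_def)

lemma card_B: "card B = d + card E"
proof -
  have "card B = card ((\<lambda>i. (i, i)) ` {..<d}) + card E"
    unfolding indices_def using finite_E by (intro card_Un_disjoint) (auto dest: E_less)
  also have "card ((\<lambda>i. (i, i)) ` {..<d}) = d" by (simp add: card_image inj_on_def)
  finally show ?thesis .
qed

lemma T_carrier: "g \<in> carrier T \<longleftrightarrow>
    (\<forall>b\<in>B. 0 \<le> g b \<and> g b < int p) \<and> (\<forall>b. b \<notin> B \<longrightarrow> g b = 0)"
  by (simp add: graph_group_def)

lemma T_mult: "(g \<otimes>\<^bsub>T\<^esub> h) (i, j) = (if (i, j) \<in> B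
    then (g (i, j) + h (i, j) + (if i < j then g (j, j) * h (i, i) else 0)) mod int p else 0)"
  by (simp add: graph_group_def)

lemma T_one: "\<one>\<^bsub>T\<^esub> = (\<lambda>_. 0)"
  by (simp add: graph_group_def)

lemma B_cases:
  assumes "(i, j) \<in> B"
  obtains "i = j" "i < d" | "i < j" "(i, j) \<in> E" "(i, i) \<in> B" "(j, j) \<in> B"
  using assms E_less[of i j] E_less_d[of i j] by (cases "i = j") auto

text \<open>Associativity at an edge coordinate. It rests on the twist \<open>u * v\<close> being
  additive in each argument; the inner reductions modulo \<open>q\<close> do not matter.\<close>

lemma twisted_assoc_mod:
  fixes a b c u v u' v' q :: int
  shows "((a + b + u * v) mod q + c + ((u + u') mod q) * v') mod q
    = (a + (b + c + u' * v') mod q + u * ((v + v') mod q)) mod q"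
proof -
  have "((a + b + u * v) mod q + c + ((u + u') mod q) * v') mod q
      = (a + b + u * v + c + (u + u') * v') mod q"
    by (intro mod_add_cong) (simp_all add: mod_simps)
  also have "\<dots> = (a + (b + c + u' * v') + u * (v + v')) mod q"
    by (simp add: algebra_simps)
  also have "\<dots> = (a + (b + c + u' * v') mod q + u * ((v + v') mod q)) mod q"
    by (intro mod_add_cong) (simp_all add: mod_simps)
  finally show ?thesis .
qed

lemma twisted_mod:
  fixes a b c k q :: int
  shows "(a mod q + b + (c mod q) * k) mod q = (a + b + c * k) mod q"
  by (intro mod_add_cong) (simp_all add: mod_simps)

lemma T_mult_closed: "g \<otimes>\<^bsub>T\<^esub> h \<in> carrier T"
  using p_gt1 by (auto simp: T_carrier T_mult)

lemma group_T: "group T"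
proof (rule groupI)
  fix g h k assume "g \<in> carrier T" "h \<in> carrier T" "k \<in> carrier T"
  show "g \<otimes>\<^bsub>T\<^esub> h \<otimes>\<^bsub>T\<^esub> k = g \<otimes>\<^bsub>T\<^esub> (h \<otimes>\<^bsub>T\<^esub> k)"
  proof (intro ext, clarify)
    fix i j
    show "(g \<otimes>\<^bsub>T\<^esub> h \<otimes>\<^bsub>T\<^esub> k) (i, j) = (g \<otimes>\<^bsub>T\<^esub> (h \<otimes>\<^bsub>T\<^esub> k)) (i, j)"
    proof (cases "(i, j) \<in> B")
      case True
      then show ?thesis
        by (cases rule: B_cases)
          (simp add: T_mult mod_simps add.assoc, simp add: T_mult twisted_assoc_mod)
    qed (simp add: T_mult)
  qed
next
  fix g assume g: "g \<in> carrier T"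
  have "(\<one>\<^bsub>T\<^esub> \<otimes>\<^bsub>T\<^esub> g) (i, j) = g (i, j)" for i j
    using g by (auto simp: T_mult T_carrier T_one)
  then show "\<one>\<^bsub>T\<^esub> \<otimes>\<^bsub>T\<^esub> g = g" by auto
  define h where "h = (\<lambda>(i, j). if (i, j) \<in> B
    then (- g (i, j) + (if i < j then g (j, j) * g (i, i) else 0)) mod int p else 0)"
  have "h \<in> carrier T" using p_gt1 by (auto simp: T_carrier h_def)
  moreover have "(h \<otimes>\<^bsub>T\<^esub> g) (i, j) = 0" for i j
  proof (cases "(i, j) \<in> B")
    case True
    then show ?thesis
      by (cases rule: B_cases) (simp add: T_mult h_def mod_simps, simp add: T_mult h_def twisted_mod)
  qed (simp add: T_mult)
  ultimately show "\<exists>h\<in>carrier T. h \<otimes>\<^bsub>T\<^esub> g = \<one>\<^bsub>T\<^esub>" by (auto simp: T_one fun_eq_iff)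
qed (use p_gt1 in \<open>auto simp: T_mult_closed\<close>, auto simp: T_carrier T_one)

lemma card_T: "finite (carrier T) \<and> card (carrier T) = p ^ (d + card E)"
proof -
  have "card (carrier T) = p ^ (d + card E)"
    using card_bounded_functions[OF finite_B, of p] p_gt1 by (simp add: graph_group_def card_B)
  moreover have "p ^ (d + card E) \<noteq> 0" using p_gt1 by simp
  ultimately show ?thesis by (metis card.infinite)
qed

end

text \<open>Working with any group that is identified with \<open>graph_group\<close> through
  coordinates \<open>co\<close> makes the results available for a copy on the natural
  numbers.\<close>

locale shifted_group = shifted_graph p d \<delta> E + group H
  for p d \<delta> E and H :: "('a, 'b) monoid_scheme" (structure) +
  fixes co :: "'a \<Rightarrow> nat \<times> nat \<Rightarrow> int"
  assumes co_iso: "co \<in> iso H (graph_group p d E)"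
begin

lemma co_closed: "x \<in> carrier H \<Longrightarrow> co x \<in> carrier T"
  using co_iso by (auto simp: iso_def hom_def)

lemma co_mult: "x \<in> carrier H \<Longrightarrow> y \<in> carrier H \<Longrightarrow> co (x \<otimes> y) (i, j) = (if (i, j) \<in> B
    then (co x (i, j) + co y (i, j) + (if i < j then co x (j, j) * co y (i, i) else 0)) mod int p else 0)"
  using co_iso by (simp add: iso_def hom_def T_mult)

lemma co_one: "co \<one> = (\<lambda>_. 0)"
  using co_iso group_T hom_one[of co H T] is_group by (simp add: iso_def T_one)

lemma co_inj: "x \<in> carrier H \<Longrightarrow> y \<in> carrier H \<Longrightarrow> (\<And>i j. co x (i, j) = co y (i, j)) \<Longrightarrow> x = y"
  using co_iso by (auto simp: iso_def bij_betw_def inj_on_def fun_eq_iff)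

lemma co_range: "x \<in> carrier H \<Longrightarrow> b \<in> B \<Longrightarrow> 0 \<le> co x b \<and> co x b < int p"
  using co_closed by (auto simp: T_carrier)

lemma co_mod [simp]: "x \<in> carrier H \<Longrightarrow> co x b mod int p = co x b"
  using co_closed[of x] by (cases "b \<in> B") (simp_all add: T_carrier del: split_paired_All)

lemma co_nonneg: "x \<in> carrier H \<Longrightarrow> 0 \<le> co x b"
  using co_closed[of x] by (cases "b \<in> B") (simp_all add: T_carrier del: split_paired_All)

lemma co_outside: "x \<in> carrier H \<Longrightarrow> b \<notin> B \<Longrightarrow> co x b = 0"
  using co_closed[of x] by (simp add: T_carrier del: split_paired_All)

lemma co_eq_0_iff: "x \<in> carrier H \<Longrightarrow> co x b = 0 \<longleftrightarrow> int p dvd co x b"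
  using co_mod[of x b] by (auto simp: dvd_eq_mod_eq_0)

lemma finite_H: "finite (carrier H)" and card_H: "card (carrier H) = p ^ (d + card E)"
proof -
  have "bij_betw co (carrier H) (carrier T)" using co_iso by (simp add: iso_def)
  then show "finite (carrier H)" "card (carrier H) = p ^ (d + card E)"
    using card_T bij_betw_finite bij_betw_same_card by metis+
qed

definition elt :: "(nat \<times> nat \<Rightarrow> int) \<Rightarrow> 'a" where "elt = inv_into (carrier H) co"

lemma elt: "g \<in> carrier T \<Longrightarrow> elt g \<in> carrier H \<and> co (elt g) = g"
proof -
  assume "g \<in> carrier T"
  then have "g \<in> co ` carrier H" using co_iso by (simp add: iso_def bij_betw_def)
  then show ?thesis unfolding elt_def by (simp add: inv_into_into f_inv_into_f)
qed

definition gen :: "nat \<times> nat \<Rightarrow> 'a" where "gen b = elt (\<lambda>b'. if b' = b then 1 else 0)"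

lemma gen_T: "b \<in> B \<Longrightarrow> (\<lambda>b'. if b' = b then 1 else 0) \<in> carrier T"
  using p_gt1 by (auto simp: T_carrier)

lemma gen_closed [simp]: "b \<in> B \<Longrightarrow> gen b \<in> carrier H"
  and co_gen: "b \<in> B \<Longrightarrow> co (gen b) b' = (if b' = b then 1 else 0)"
  using elt[OF gen_T] by (auto simp: gen_def)

abbreviation "vtx i \<equiv> gen (i, i)"

text \<open>Among \<open>n\<close> equal factors there are \<open>n choose 2\<close> pairs, and
  collecting each pair contributes one twist.\<close>

lemma co_nat_pow:
  assumes "x \<in> carrier H"
  shows "co (x [^] (n::nat)) (i, j) = (if (i, j) \<in> B
    then (int n * co x (i, j) + (if i < j then int (n choose 2) * (co x (j, j) * co x (i, i)) else 0)) mod int p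
    else 0)"
proof (induction n arbitrary: i j)
  case 0
  then show ?case by (simp add: co_one numeral_2_eq_2)
next
  case (Suc n)
  have c: "Suc n choose 2 = (n choose 2) + n" by (simp add: numeral_2_eq_2)
  show ?case
  proof (cases "(i, j) \<in> B")
    case True
    then show ?thesis
      by (cases rule: B_cases)
        (use assms in \<open>simp add: co_mult Suc.IH mod_simps algebra_simps,
           simp add: co_mult Suc.IH twisted_mod, simp add: c algebra_simps\<close>)
  qed (use assms in \<open>simp add: co_mult\<close>)
qed

text \<open>For odd \<open>p\<close> the binomial \<open>p choose 2\<close> is divisible by
  \<open>p\<close>, so both terms of the coordinate of the power vanish modulo
  \<open>p\<close>.\<close>

lemma pow_p: assumes "x \<in> carrier H" shows "x [^] p = \<one>"
proof -
  have "p dvd p choose 2"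
    using prime_p odd_p p_gt1 by (intro dvd_choose_prime) (auto intro!: le_neq_implies_less)
  then have "int p dvd int (p choose 2)" by simp
  then have "int (p choose 2) mod int p = 0" by simp
  then have "(int p * a + int (p choose 2) * b) mod int p = 0" for a b
    by (metis \<open>int p dvd int (p choose 2)\<close> dvd_add dvd_eq_mod_eq_0 dvd_mult2 dvd_refl)
  then have "co (x [^] p) (i, j) = 0" for i j using assms by (simp add: co_nat_pow)
  then show ?thesis using assms by (intro co_inj) (auto simp: co_one)
qed

lemma co_gen_pow:
  assumes "b \<in> B" "0 \<le> a"
  shows "co (gen b [^] (a::int)) b' = (if b' = b then a mod int p else 0)"
proof -
  obtain n where a: "a = int n" using assms(2) nonneg_int_cases by blast
  obtain i j where b': "b' = (i, j)" by force
  show ?thesis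
    unfolding a b' int_pow_int using assms
    by (cases "(i, j) \<in> B") (auto simp: co_nat_pow co_gen)
qed

lemma group_exponent_H: "group_exponent H = p"
proof -
  have "p \<le> n" if "0 < n" "\<forall>x\<in>carrier H. x [^] n = \<one>" for n :: nat
  proof -
    have "co (vtx 0 [^] n) (0, 0) = 0" using that \<delta>_ge \<delta>_le by (simp add: co_one)
    then have "int n mod int p = 0" using \<delta>_ge \<delta>_le by (simp add: co_nat_pow co_gen)
    then have "p dvd n" by (simp add: zmod_int[symmetric] dvd_eq_mod_eq_0 flip: of_nat_mod)
    then show ?thesis using that(1) by (rule dvd_imp_le)
  qed
  then show ?thesis
    unfolding group_exponent_def using p_gt1 pow_p by (intro Least_equality) auto
qed

lemma commute_iff:
  assumes "x \<in> carrier H" "y \<in> carrier H"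
  shows "x \<otimes> y = y \<otimes> x \<longleftrightarrow> (\<forall>(i, j)\<in>E. (co x (j, j) * co y (i, i)) mod int p = (co y (j, j) * co x (i, i)) mod int p)"
proof -
  have "x \<otimes> y = y \<otimes> x \<longleftrightarrow> (\<forall>i j. co (x \<otimes> y) (i, j) = co (y \<otimes> x) (i, j))"
    using assms by (metis co_inj m_closed)
  also have "\<dots> \<longleftrightarrow> (\<forall>(i, j)\<in>E. co (x \<otimes> y) (i, j) = co (y \<otimes> x) (i, j))"
    using assms by (auto simp: co_mult add.commute elim!: B_cases)
  also have "\<dots> \<longleftrightarrow> (\<forall>(i, j)\<in>E. (co x (j, j) * co y (i, i)) mod int p = (co y (j, j) * co x (i, i)) mod int p)"
  proof (rule ball_cong[OF refl], clarify)
    fix i j assume "(i, j) \<in> E"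
    then have "co (x \<otimes> y) (i, j) = co (y \<otimes> x) (i, j) \<longleftrightarrow>
        (co x (i, j) + co y (i, j) + co x (j, j) * co y (i, i)
        ) mod int p = (co x (i, j) + co y (i, j) + co y (j, j) * co x (i, i)) mod int p"
      using assms E_less[of i j] by (simp add: co_mult add.commute)
    then show "co (x \<otimes> y) (i, j) = co (y \<otimes> x) (i, j) \<longleftrightarrow>
        (co x (j, j) * co y (i, i)) mod int p = (co y (j, j) * co x (i, i)) mod int p"
      by (simp add: mod_eq_dvd_iff)
  qed
  finally show ?thesis .
qed

text \<open>The vertex \<open>\<delta> - 1\<close> is adjacent to all others below
  \<open>\<delta>\<close>: commuting with its generator kills the diagonal coordinates below
  \<open>\<delta> - 1\<close>, and commuting with \<open>vtx 0\<close> kills the one at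
  \<open>\<delta> - 1\<close>.\<close>

lemma center_H: "group_center H = {x \<in> carrier H. \<forall>i<\<delta>. co x (i, i) = 0}"
proof (intro equalityI subsetI)
  fix x assume "x \<in> group_center H"
  then have x: "x \<in> carrier H" and c: "\<And>y. y \<in> carrier H \<Longrightarrow> x \<otimes> y = y \<otimes> x"
    by (auto simp: group_center_def)
  have "co x (i, i) = 0" if "i < \<delta>" for i
  proof (cases "i = \<delta> - 1")
    case True
    have "x \<otimes> vtx 0 = vtx 0 \<otimes> x" using c \<delta>_ge \<delta>_le by simp
    then have "(co x (\<delta> - 1, \<delta> - 1) * 1) mod int p = (0 * co x (0, 0)) mod int p"
      using x \<delta>_ge \<delta>_le E_top by (auto simp: commute_iff co_gen)
    then show ?thesis using True x by simp
  next
    case False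
    then have "(i, \<delta> - 1) \<in> E" using E_up[OF E_top, of i "\<delta> - 1"] that by simp
    moreover have "x \<otimes> vtx (\<delta> - 1) = vtx (\<delta> - 1) \<otimes> x" using c \<delta>_ge \<delta>_le by simp
    ultimately have "(co x (\<delta> - 1, \<delta> - 1) * 0) mod int p = (1 * co x (i, i)) mod int p"
      using x \<delta>_ge \<delta>_le False by (auto simp: commute_iff co_gen)
    then show ?thesis using x by simp
  qed
  then show "x \<in> {x \<in> carrier H. \<forall>i<\<delta>. co x (i, i) = 0}" using x by auto
next
  fix x assume x: "x \<in> {x \<in> carrier H. \<forall>i<\<delta>. co x (i, i) = 0}"
  then have "co x (i, i) = 0" "co x (j, j) = 0" if "(i, j) \<in> E" for i j
    using E_less[OF that] by auto
  then show "x \<in> group_center H" using x by (auto simp: group_center_def commute_iff)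
qed

lemma vtx_exchange:
  assumes "i < j" "j < d"
  shows "vtx j \<otimes> vtx i = (if (i, j) \<in> E then vtx i \<otimes> vtx j \<otimes> gen (i, j) else vtx i \<otimes> vtx j)"
  using assms p_gt1 E_less
  by (intro co_inj) (auto simp: co_mult co_gen elim!: B_cases)

end

context group
begin

lemma quotient_elementary_abelian:
  fixes p :: nat
  assumes "N \<lhd> G" and exp: "\<And>x. x \<in> carrier G \<Longrightarrow> x [^] p = \<one>"
    and com: "derived G (carrier G) \<subseteq> N"
  shows "comm_group (G Mod N)"
    and "x \<in> carrier (G Mod N) \<Longrightarrow> x [^]\<^bsub>G Mod N\<^esub> p = \<one>\<^bsub>G Mod N\<^esub>"
proof -
  interpret N: normal N G by fact
  have one: "\<one>\<^bsub>G Mod N\<^esub> = N" by (simp add: FactGroup_def)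
  have "N #> (a \<otimes> b) = N #> (b \<otimes> a)" if "a \<in> carrier G" "b \<in> carrier G" for a b
  proof -
    have "a \<otimes> b \<otimes> inv a \<otimes> inv b \<in> N"
      using com that unfolding derived_def by (blast intro: generate.incl)
    moreover have "a \<otimes> b \<otimes> inv a \<otimes> inv b \<otimes> (b \<otimes> a) = a \<otimes> b"
      using that by (simp add: m_assoc)
         (simp add: m_assoc[symmetric])
    ultimately have "a \<otimes> b \<in> N #> (b \<otimes> a)" unfolding r_coset_def by force
    then show ?thesis using that by (metis N.subgroup_axioms m_closed repr_independence)
  qed
  then show "comm_group (G Mod N)"
    by (intro group.group_comm_groupI N.factorgroup_is_group)
      (auto simp: carrier_FactGroup N.rcos_sum FactGroup_def RCOSETS_def)
  show "x [^]\<^bsub>G Mod N\<^esub> p = \<one>\<^bsub>G Mod N\<^esub>" if "x \<in> carrier (G Mod N)"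
    using that exp N.FactGroup_pow N.subset by (auto simp: carrier_FactGroup one coset_join2)
qed

lemma card_quotient:
  assumes "N \<lhd> G" "finite (carrier G)"
  shows "card (carrier (G Mod N)) * card N = card (carrier G)"
  using lagrange[OF normal_imp_subgroup[OF assms(1)]] by (simp add: FactGroup_def order_def)

end

section \<open>Normal form, commutator subgroup, centre and numbers of generators\<close>

context shifted_group
begin

lemma E_B: "e \<in> E \<Longrightarrow> e \<in> B"
  by (simp add: indices_def)

lemma co_gen_diag: "e \<in> E \<Longrightarrow> co (gen e) (i, i) = 0"
  using E_less[of i i] by (auto simp: co_gen E_B)

text \<open>Any enumeration serves, since the elements \<open>gen e\<close> over the edges
  commute.\<close>

definition edge_list :: "(nat \<times> nat) list" where
  "edge_list = (SOME es. set es = E \<and> distinct es)"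

lemma edge_list: "set edge_list = E" "distinct edge_list"
  using someI_ex[OF finite_distinct_list[OF finite_E]] by (simp_all add: edge_list_def)

lemma collecting: "collecting H vtx gen d edge_list"
proof
  fix e i assume "e \<in> set edge_list" "i < d"
  then show "gen e \<otimes> vtx i = vtx i \<otimes> gen e"
    by (subst commute_iff) (auto simp: edge_list E_B co_gen_diag)
next
  fix e e' assume "e \<in> set edge_list" "e' \<in> set edge_list"
  then show "gen e \<otimes> gen e' = gen e' \<otimes> gen e"
    by (subst commute_iff) (auto simp: edge_list E_B co_gen_diag)
qed (use edge_list E_less_d E_less in \<open>auto simp: vtx_exchange E_B\<close>)

sublocale col: collecting H vtx gen d edge_list by (rule collecting)

text \<open>In a product along an increasing list no larger generator precedes a smaller one, so no
  twist arises and the edge coordinates stay zero.\<close>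

lemma co_xprod:
  assumes "sorted_wrt (<) L" "set L \<subseteq> {..<d}" "\<And>i. 0 \<le> v i"
  shows "co (col.xprod v L) (i, j) = (if i = j \<and> i \<in> set L then v i mod int p else 0)"
  using assms(1,2)
proof (induction L arbitrary: i j)
  case (Cons k L)
  have cl: "vtx k \<in> carrier H" "col.xprod v L \<in> carrier H" using Cons.prems by (auto simp: col.xprod_closed)
  have kB: "(k, k) \<in> B" using Cons.prems by simp
  show ?case
  proof (cases "(i, j) \<in> B")
    case True
    then show ?thesis
      by (cases rule: B_cases)
        (use Cons cl kB in \<open>auto simp: co_mult co_gen_pow assms(3)\<close>)
  qed (use Cons cl in \<open>auto simp: co_mult\<close>)
qed (simp add: co_one)

lemma co_yprod:
  assumes "distinct L" "set L \<subseteq> E" "\<And>e. 0 \<le> w e"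
  shows "co (pow_prod H gen w L) b = (if b \<in> set L then w b mod int p else 0)"
  using assms(1,2)
proof (induction L arbitrary: b)
  case (Cons e L)
  have LB: "set (e # L) \<subseteq> B" using Cons.prems by (auto simp: indices_def)
  have cl: "gen e \<in> carrier H" "pow_prod H gen w L \<in> carrier H"
    using LB by (auto intro!: pow_prod_closed gen_closed)
  have dg: "(i, i) \<notin> set (e # L)" for i using Cons.prems E_less by blast
  obtain i j where b: "b = (i, j)" by force
  have neq: "(j, j) \<noteq> e" using dg by auto
  show ?case
  proof (cases "(i, j) \<in> B")
    case True
    then show ?thesis
      unfolding b using Cons cl LB dg neq
      by (auto simp: co_mult co_gen_pow assms(3))
  qed (use Cons cl LB in \<open>auto simp: b co_mult\<close>)
qed (simp add: co_one)

text \<open>The coordinates are the exponents of the collected word; this is how abstract elements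
  are turned into words in the generators.\<close>

lemma normal_form:
  assumes "x \<in> carrier H"
  shows "x = col.xprod (\<lambda>i. co x (i, i)) [0..<d] \<otimes> col.yprod (co x)"
proof (rule co_inj)
  have cl: "col.xprod (\<lambda>i. co x (i, i)) [0..<d] \<in> carrier H" "col.yprod (co x) \<in> carrier H"
    by (auto simp: col.xprod_closed)
  then show "col.xprod (\<lambda>i. co x (i, i)) [0..<d] \<otimes> col.yprod (co x) \<in> carrier H" by simp
  fix i j
  have 1: "co (col.xprod (\<lambda>i. co x (i, i)) [0..<d]) (i, j) = (if i = j \<and> i < d then co x (i, i) else 0)" for i j
    using assms by (subst co_xprod) (auto simp: co_nonneg)
  have 2: "co (col.yprod (co x)) b = (if b \<in> E then co x b else 0)" for b
    using assms edge_list by (subst co_yprod) (auto simp: co_nonneg)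
  show "co x (i, j) = co (col.xprod (\<lambda>i. co x (i, i)) [0..<d] \<otimes> col.yprod (co x)) (i, j)"
  proof (cases "(i, j) \<in> B")
    case True
    then show ?thesis
      by (cases rule: B_cases) (use assms cl E_less in \<open>auto simp: co_mult 1 2\<close>)
  qed (use assms cl in \<open>simp add: co_mult co_outside\<close>)
qed (fact assms)

lemma gen_commutator:
  assumes "(i, j) \<in> E"
  shows "gen (i, j) = vtx j \<otimes> vtx i \<otimes> inv (vtx j) \<otimes> inv (vtx i)"
proof -
  have ij: "i < j" "j < d" "(i, j) \<in> set edge_list" using assms E_less E_less_d edge_list by auto
  have cl: "vtx i \<in> carrier H" "vtx j \<in> carrier H" "gen (i, j) \<in> carrier H" using ij by auto
  have "vtx j \<otimes> vtx i = vtx i \<otimes> vtx j \<otimes> gen (i, j)" using vtx_exchange[OF ij(1,2)] assms by simp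
  also have "\<dots> = gen (i, j) \<otimes> (vtx i \<otimes> vtx j)"
    using commute_mult[OF cl(3,1,2)] col.yx[OF ij(3)] ij by auto
  finally have "vtx j \<otimes> vtx i \<otimes> inv (vtx i \<otimes> vtx j) = gen (i, j)"
    using cl by (simp add: m_assoc)
  then show ?thesis using cl by (simp add: inv_mult_group m_assoc)
qed

lemma subgroup_contains_gen:
  assumes "subgroup U H" "(i, j) \<in> E" "vtx i \<in> U" "vtx j \<in> U"
  shows "gen (i, j) \<in> U"
  unfolding gen_commutator[OF assms(2)]
  using assms by (intro subgroup.m_closed subgroup.m_inv_closed)

lemma generate_vtx: "generate H (vtx ` {..<d}) = carrier H"
proof
  let ?U = "generate H (vtx ` {..<d})"
  have U: "subgroup ?U H" by (rule generate_is_subgroup) auto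
  have v: "vtx i \<in> ?U" if "i < d" for i using that by (auto intro: generate.incl)
  have g: "gen (i, j) \<in> ?U" if "(i, j) \<in> E" for i j
    using subgroup_contains_gen[OF U that] E_less_d[OF that] v by auto
  show "carrier H \<subseteq> ?U"
  proof
    fix x assume x: "x \<in> carrier H"
    have "col.xprod (\<lambda>i. co x (i, i)) [0..<d] \<otimes> col.yprod (co x) \<in> ?U"
      using v g edge_list by (intro subgroup.m_closed[OF U] subgroup_pow_prod[OF U]) auto
    then show "x \<in> ?U" by (subst normal_form[OF x])
  qed
  show "?U \<subseteq> carrier H" using U by (rule subgroup.subset)
qed

text \<open>Taken with \<open>m = \<delta>\<close> for the centre and with \<open>m = d\<close> for
  the commutator subgroup.\<close>

lemma subgroup_vanishing:
  assumes "m \<le> d"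
  shows "subgroup {x \<in> carrier H. \<forall>i<m. co x (i, i) = 0} H"
proof (rule subgroupI)
  fix x assume x: "x \<in> {x \<in> carrier H. \<forall>i<m. co x (i, i) = 0}"
  have "co (inv x) (i, i) = 0" if "i < m" for i
  proof -
    have "co (inv x \<otimes> x) (i, i) = 0" using x by (simp add: co_one)
    then show ?thesis using x that assms co_mult[of "inv x" x i i] by simp
  qed
  then show "inv x \<in> {x \<in> carrier H. \<forall>i<m. co x (i, i) = 0}" using x by simp
next
  show "{x \<in> carrier H. \<forall>i<m. co x (i, i) = 0} \<noteq> {}"
    using co_one by (auto intro!: exI[of _ \<one>])
qed (use assms in \<open>auto simp: co_mult\<close>)

text \<open>A cycle of inclusions: \<open>?V\<close> lies in \<open>?W\<close> by the normal form,
  \<open>?W\<close> in \<open>?D\<close> because each \<open>gen e\<close> is a commutator, and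
  \<open>?D\<close> in \<open>?V\<close> because diagonal coordinates are additive modulo
  \<open>p\<close>.\<close>

lemma commutator_subgroup_eq: "derived H (carrier H) = generate H (gen ` E)" (is "?D = ?W")
  and commutator_subgroup_H: "commutator_subgroup H = {x \<in> carrier H. \<forall>i<d. co x (i, i) = 0}"
    (is "_ = ?V")
proof -
  have gE: "gen ` E \<subseteq> carrier H" using E_B by auto
  have W: "subgroup ?W H" using gE by (rule generate_is_subgroup)
  have VW: "?V \<subseteq> ?W"
  proof
    fix x assume x: "x \<in> ?V"
    have "col.xprod (\<lambda>i. co x (i, i)) [0..<d] = col.xprod (\<lambda>i. 0) [0..<d]"
      using x by (intro pow_prod_cong) auto
    moreover have "col.yprod (co x) \<in> ?W"
      using edge_list by (intro subgroup_pow_prod[OF W]) (auto intro: generate.incl)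
    ultimately show "x \<in> ?W" using normal_form[of x] x col.yprod_closed by auto
  qed
  have "vtx j \<otimes> vtx i \<otimes> inv (vtx j) \<otimes> inv (vtx i) \<in> ?D" if "(i, j) \<in> E" for i j
    using E_less_d[OF that] unfolding derived_def by (force intro!: generate.incl)
  then have WD: "?W \<subseteq> ?D"
    by (intro generate_subgroup_incl derived_is_subgroup) (auto simp: gen_commutator)
  have V: "subgroup ?V H" by (rule subgroup_vanishing) simp
  have "?D \<subseteq> ?V"
    unfolding derived_def
  proof (rule generate_subgroup_incl[OF _ V], safe)
    fix x y i assume xy: "x \<in> carrier H" "y \<in> carrier H"
    let ?c = "x \<otimes> y \<otimes> inv x \<otimes> inv y"
    show "?c \<in> carrier H" using xy by simp
    assume i: "i < d"
    have "?c \<otimes> (y \<otimes> x) = x \<otimes> y" using xy by (simp add: m_assoc) (simp add: m_assoc[symmetric])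
    then have "co (?c \<otimes> (y \<otimes> x)) (i, i) = co (x \<otimes> y) (i, i)" by simp
    then have "(co ?c (i, i) + (co y (i, i) + co x (i, i))) mod int p = (co x (i, i) + co y (i, i)) mod int p"
      using xy i by (simp add: co_mult[of ?c] co_mult[of x y] co_mult[of y x] mod_simps)
    then have "int p dvd co ?c (i, i)" by (simp add: mod_eq_dvd_iff)
    then show "co ?c (i, i) = 0" using xy by (simp add: co_eq_0_iff)
  qed
  then show "?D = ?W" "commutator_subgroup H = ?V"
    using VW WD by (auto simp: commutator_subgroup_def)
qed

lemma subgroup_commutator: "subgroup (commutator_subgroup H) H"
  unfolding commutator_subgroup_def by (rule derived_is_subgroup) simp

lemma nilpotent_H: "nilpotent_class_two H"
proof -
  have e: "(0, \<delta> - 1) \<in> E" "0 < \<delta> - 1" "0 < d" using E_top E_less \<delta>_le \<delta>_ge by auto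
  have "gen (0, \<delta> - 1) \<in> commutator_subgroup H"
    using e by (auto simp: commutator_subgroup_H co_gen)
  moreover have "gen (0, \<delta> - 1) \<noteq> \<one>" using co_gen[of "(0, \<delta> - 1)" "(0, \<delta> - 1)"] e by (auto simp: co_one)
  moreover have "commutator_subgroup H \<subseteq> group_center H"
    using \<delta>_le by (auto simp: commutator_subgroup_H center_H)
  ultimately show ?thesis unfolding nilpotent_class_two_def by auto
qed

lemma card_co_subset:
  assumes "S \<subseteq> B"
  shows "card {x \<in> carrier H. \<forall>b\<in>B - S. co x b = 0} = p ^ card S"
proof -
  let ?A = "{x \<in> carrier H. \<forall>b\<in>B - S. co x b = 0}"
  let ?C = "{g. (\<forall>b\<in>S. 0 \<le> g b \<and> g b < int p) \<and> (\<forall>b. b \<notin> S \<longrightarrow> g b = 0)}"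
  have im: "co ` ?A = ?C"
  proof
    show "co ` ?A \<subseteq> ?C"
      using assms co_range co_outside by blast
    show "?C \<subseteq> co ` ?A"
    proof
      fix g assume g: "g \<in> ?C"
      then have 0: "b \<notin> S \<Longrightarrow> g b = 0" and S: "b \<in> S \<Longrightarrow> 0 \<le> g b \<and> g b < int p" for b
        by (simp_all del: split_paired_All)
      have "0 \<le> g b \<and> g b < int p" for b using 0[of b] S[of b] p_gt1 by (cases "b \<in> S") simp_all
      then have "g \<in> carrier T" using 0 assms
        by (simp add: T_carrier subset_iff del: split_paired_All) blast
      note e = elt[OF this]
      then have A: "elt g \<in> ?A" and eq: "co (elt g) = g"
        using 0 by (simp_all del: split_paired_All split_paired_Ball_Sigma)
      show "g \<in> co ` ?A" by (rule image_eqI[where x = "elt g"]) (fact eq[symmetric], fact A)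
    qed
  qed
  have "inj_on co ?A" using co_iso by (auto simp: iso_def bij_betw_def inj_on_def)
  from card_image[OF this, symmetric] have "card ?A = card ?C" unfolding im .
  also have "\<dots> = p ^ card S"
    using p_gt1 finite_subset[OF assms finite_B] by (intro card_bounded_functions) auto
  finally show ?thesis .
qed

lemma card_commutator: "card (commutator_subgroup H) = p ^ card E"
proof -
  have "commutator_subgroup H = {x \<in> carrier H. \<forall>b\<in>B - E. co x b = 0}"
    unfolding commutator_subgroup_H by (auto simp: indices_def dest: E_less)
  then show ?thesis using card_co_subset[of E] by (simp add: indices_def)
qed

lemma card_center: "card (group_center H) * p ^ \<delta> = p ^ (d + card E)"
proof -
  let ?S = "B - (\<lambda>i. (i, i)) ` {..<\<delta>}"
  have "group_center H = {x \<in> carrier H. \<forall>b\<in>B - ?S. co x b = 0}"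
    unfolding center_H using \<delta>_le by auto
  then have "card (group_center H) = p ^ card ?S" using card_co_subset[of ?S] by simp
  moreover have "card ?S + card ((\<lambda>i. (i, i)) ` {..<\<delta>}) = card B"
    using \<delta>_le finite_B by (subst card_Diff_subset) (auto intro!: le_add_diff_inverse2 card_mono)
  moreover have "card ((\<lambda>i. (i, i)) ` {..<\<delta>}) = \<delta>" by (simp add: card_image inj_on_def)
  ultimately show ?thesis by (metis card_B power_add)
qed

lemma normal_commutator: "commutator_subgroup H \<lhd> H"
  unfolding commutator_subgroup_def by (rule derived_self_is_normal)

lemma normal_center: "group_center H \<lhd> H"
proof -
  have "subgroup (group_center H) H"
    unfolding center_H by (rule subgroup_vanishing[OF \<delta>_le])
  moreover have "x \<otimes> h \<otimes> inv x \<in> group_center H" if "x \<in> carrier H" "h \<in> group_center H" for x h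
  proof -
    have "h \<in> carrier H" "x \<otimes> h = h \<otimes> x" using that by (auto simp: group_center_def)
    then show ?thesis using that by (simp add: m_assoc)
  qed
  ultimately show ?thesis by (simp add: normal_inv_iff)
qed

text \<open>The quotient by \<open>N\<close> is elementary abelian, so its order bounds the
  generating sets of \<open>H\<close> as well as its own.\<close>

lemma generators_ge:
  assumes "N \<lhd> H" "commutator_subgroup H \<subseteq> N" "card (carrier (H Mod N)) = p ^ n"
  shows "S \<subseteq> carrier H \<Longrightarrow> finite S \<Longrightarrow> generate H S = carrier H \<Longrightarrow> n \<le> card S"
    and "S' \<subseteq> carrier (H Mod N) \<Longrightarrow> finite S' \<Longrightarrow> generate (H Mod N) S' = carrier (H Mod N) \<Longrightarrow> n \<le> card S'"
proof -
  interpret N: normal N H by fact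
  note q = quotient_elementary_abelian[OF assms(1) pow_p assms(2)[unfolded commutator_subgroup_def]]
  interpret Q: comm_group "H Mod N" by (rule q)
  interpret h: group_hom H "H Mod N" "\<lambda>x. N #> x"
    using N.r_coset_hom_Mod by unfold_locales
  have i: "group_hom (H Mod N) (H Mod N) (\<lambda>x. x)"
    by unfold_locales (auto simp: hom_def)
  show "S \<subseteq> carrier H \<Longrightarrow> finite S \<Longrightarrow> generate H S = carrier H \<Longrightarrow> n \<le> card S"
    by (rule h.card_generators_ge[OF q(1) p_gt1 q(2) assms(3)]) (auto simp: carrier_FactGroup)
  show "S' \<subseteq> carrier (H Mod N) \<Longrightarrow> finite S' \<Longrightarrow> generate (H Mod N) S' = carrier (H Mod N) \<Longrightarrow> n \<le> card S'"
    by (rule group_hom.card_generators_ge[OF i q(1) p_gt1 q(2) assms(3)]) auto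
qed

lemma min_gens_H: "min_gens H = d"
proof (rule min_gens_eqI[of "vtx ` {..<d}"])
  have "card (carrier (H Mod commutator_subgroup H)) * p ^ card E = p ^ d * p ^ card E"
    using card_quotient[OF normal_commutator finite_H] by (simp add: card_commutator card_H power_add)
  then have "card (carrier (H Mod commutator_subgroup H)) = p ^ d" using p_gt1 by simp
  then show "d \<le> card S" if "S \<subseteq> carrier H" "finite S" "generate H S = carrier H" for S
    using generators_ge(1)[OF normal_commutator _ _ that] by simp
  show "card (vtx ` {..<d}) \<le> d" using card_image_le[of "{..<d}" vtx] by simp
qed (auto simp: generate_vtx)

lemma min_gens_central_quotient: "min_gens (H Mod group_center H) = \<delta>"
proof -
  let ?Z = "group_center H" and ?Q = "H Mod group_center H"
  let ?S = "(\<lambda>i. ?Z #> vtx i) ` {..<\<delta>}"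
  interpret Z: normal ?Z H by (rule normal_center)
  interpret Q: group ?Q by (rule Z.factorgroup_is_group)
  interpret h: group_hom H ?Q "\<lambda>x. ?Z #> x"
    using Z.r_coset_hom_Mod by unfold_locales
  have S: "?S \<subseteq> carrier ?Q" using \<delta>_le by (auto simp: carrier_FactGroup)
  have "carrier ?Q = (\<lambda>x. ?Z #> x) ` generate H (vtx ` {..<d})"
    by (simp add: generate_vtx carrier_FactGroup)
  also have "\<dots> = generate ?Q ((\<lambda>x. ?Z #> x) ` vtx ` {..<d})"
    by (rule h.generate_img[symmetric]) auto
  also have "\<dots> \<subseteq> generate ?Q ?S"
  proof (rule Q.generate_subgroup_incl[OF _ Q.generate_is_subgroup[OF S]], safe)
    fix i assume i: "i < d"
    show "?Z #> vtx i \<in> generate ?Q ?S"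
    proof (cases "i < \<delta>")
      case False
      \<comment> \<open>Generators from \<open>\<delta>\<close> on are central and die in the
        quotient, so \<open>\<delta>\<close> generators remain.\<close>
      then have "vtx i \<in> ?Z" unfolding center_H using i by (simp add: co_gen)
      then have "?Z #> vtx i = \<one>\<^bsub>?Q\<^esub>"
        by (simp add: FactGroup_def Z.rcos_const)
      then show ?thesis using generate.one[of ?Q ?S] by simp
    qed (auto intro: generate.incl)
  qed
  finally have gen: "generate ?Q ?S = carrier ?Q"
    using Q.generate_incl[OF S] by auto
  have "card (carrier ?Q) * card ?Z = p ^ \<delta> * card ?Z"
    using card_quotient[OF normal_center finite_H] card_center by (simp add: card_H mult.commute)
  moreover have "card ?Z \<noteq> 0" using card_center p_gt1 by (metis mult_is_0 not_one_less_zero power_not_zero)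
  ultimately have "card (carrier ?Q) = p ^ \<delta>" by simp
  moreover have "commutator_subgroup H \<subseteq> ?Z" using nilpotent_H by (simp add: nilpotent_class_two_def)
  ultimately show ?thesis
    using card_image_le[of "{..<\<delta>}" "\<lambda>i. ?Z #> vtx i"] generators_ge(2)[OF normal_center]
    by (intro min_gens_eqI[OF S _ gen]) auto
qed

lemma min_gens_commutator: "min_gens (H\<lparr>carrier := commutator_subgroup H\<rparr>) = card E"
proof -
  let ?W = "commutator_subgroup H" and ?G = "H\<lparr>carrier := commutator_subgroup H\<rparr>"
  have Wc: "?W \<subseteq> carrier H" by (auto simp: commutator_subgroup_H)
  interpret W: group ?G using subgroup_commutator by (rule subgroup_imp_group)
  have W: "comm_group ?G"
    using nilpotent_H Wc by (intro W.group_comm_groupI) (auto simp: nilpotent_class_two_def group_center_def)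
  have i: "group_hom ?G ?G (\<lambda>x. x)" by unfold_locales (auto simp: hom_def)
  have gE: "gen ` E \<subseteq> ?W"
    unfolding commutator_subgroup_def commutator_subgroup_eq by (auto intro: generate.incl)
  show ?thesis
  proof (rule min_gens_eqI[of "gen ` E"])
    show "generate ?G (gen ` E) = carrier ?G"
      using generate_consistent[OF gE subgroup_commutator]
      by (simp add: commutator_subgroup_def commutator_subgroup_eq)
    show "card (gen ` E) \<le> card E" using finite_E by (rule card_image_le)
    have "x [^]\<^bsub>?G\<^esub> p = \<one>\<^bsub>?G\<^esub>" if "x \<in> carrier ?G" for x
    proof -
      have "x [^]\<^bsub>?G\<^esub> p = x [^] p" by (rule nat_pow_consistent[symmetric])
      also have "\<dots> = \<one>" using that subsetD[OF Wc, of x] pow_p[of x] by simp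
      finally show ?thesis by simp
    qed
    then show "card E \<le> card S" if "S \<subseteq> carrier ?G" "finite S" "generate ?G S = carrier ?G" for S
      by (intro group_hom.card_generators_ge[OF i W p_gt1 _ _ _ that]) (auto simp: card_commutator)
  qed (use gE finite_E in auto)
qed

end

section \<open>Splitting of central extensions by the nonzero complex numbers\<close>

lemma (in group_hom) hom_pow_prod:
  "(\<And>b. b \<in> set L \<Longrightarrow> z b \<in> carrier G) \<Longrightarrow> h (pow_prod G z g L) = pow_prod H (h \<circ> z) g L"
  by (induction L) (auto simp: hom_int_pow)

text \<open>The form of the Hall--Witt identity needed here: conjugation by \<open>w\<close> multiplies \<open>u\<close> and \<open>v\<close> by
  central factors, which cancel in the commutator.\<close>

lemma (in group) commutator_centralised:
  assumes cl: "u \<in> carrier G" "v \<in> carrier G" "w \<in> carrier G" "k \<in> carrier G" "l \<in> carrier G"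
    and vw: "v \<otimes> w = w \<otimes> v \<otimes> k" and uw: "u \<otimes> w = w \<otimes> u \<otimes> l"
    and k: "k \<otimes> u = u \<otimes> k" "k \<otimes> v = v \<otimes> k" and l: "l \<otimes> u = u \<otimes> l" "l \<otimes> v = v \<otimes> l"
    and kl: "k \<otimes> l = l \<otimes> k"
  shows "inv (v \<otimes> u) \<otimes> (u \<otimes> v) \<otimes> w = w \<otimes> (inv (v \<otimes> u) \<otimes> (u \<otimes> v))"
proof -
  let ?\<phi> = "\<lambda>x. inv w \<otimes> x \<otimes> w" and ?y = "inv (v \<otimes> u) \<otimes> (u \<otimes> v)" and ?m = "k \<otimes> l"
  interpret \<phi>: group_hom G G ?\<phi>
    using conjugation_hom[OF cl(3)] by unfold_locales
  have "inv w \<otimes> (v \<otimes> w) = v \<otimes> k" "inv w \<otimes> (u \<otimes> w) = u \<otimes> l"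
    unfolding vw uw using cl by (simp_all add: m_assoc[symmetric])
  then have \<phi>: "?\<phi> v = v \<otimes> k" "?\<phi> u = u \<otimes> l" using cl by (simp_all add: m_assoc)
  have m: "?m \<otimes> u = u \<otimes> ?m" "?m \<otimes> v = v \<otimes> ?m"
    using cl k l by (metis commute_mult)+
  have "(v \<otimes> k) \<otimes> (u \<otimes> l) = v \<otimes> (k \<otimes> u) \<otimes> l" using cl by (simp add: m_assoc)
  also have "\<dots> = (v \<otimes> u) \<otimes> ?m" unfolding k using cl by (simp add: m_assoc)
  finally have 1: "(v \<otimes> k) \<otimes> (u \<otimes> l) = (v \<otimes> u) \<otimes> ?m" .
  have "(u \<otimes> l) \<otimes> (v \<otimes> k) = u \<otimes> (l \<otimes> v) \<otimes> k" using cl by (simp add: m_assoc)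
  also have "\<dots> = (u \<otimes> v) \<otimes> ?m" unfolding l kl using cl by (simp add: m_assoc)
  finally have 2: "(u \<otimes> l) \<otimes> (v \<otimes> k) = (u \<otimes> v) \<otimes> ?m" .
  have ym: "?m \<otimes> ?y = ?y \<otimes> ?m"
    using cl m by (intro commute_mult commute_inv) auto
  have "?\<phi> ?y = inv (?\<phi> v \<otimes> ?\<phi> u) \<otimes> (?\<phi> u \<otimes> ?\<phi> v)"
    using cl \<phi>.hom_mult[of "inv (v \<otimes> u)" "u \<otimes> v"] \<phi>.hom_inv[of "v \<otimes> u"] \<phi>.hom_mult[of u v] \<phi>.hom_mult[of v u]
    by (simp only: m_closed inv_closed)
  also have "\<dots> = inv ?m \<otimes> (?y \<otimes> ?m)"
    unfolding \<phi> 1 2 using cl by (simp add: inv_mult_group m_assoc)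
  also have "\<dots> = ?y"
    unfolding ym[symmetric] using cl by (simp add: inv_mult_cancel)
  finally have "inv w \<otimes> ?y \<otimes> w = ?y" .
  then have "w \<otimes> (inv w \<otimes> ?y \<otimes> w) = w \<otimes> ?y" by simp
  then show ?thesis using cl by (simp add: m_assoc[symmetric])
qed

section \<open>Sections of central extensions by collection of lifted generators\<close>

definition units_complex :: "complex monoid" where
  "units_complex = \<lparr>carrier = {z. z \<noteq> 0}, monoid.mult = (*), one = 1\<rparr>"

lemma comm_group_units_complex: "comm_group units_complex"
  by (rule comm_groupI) (auto simp: units_complex_def intro!: exI[of _ "inverse _"])

text \<open>Divisibility of the nonzero complex numbers allows lifts to be rescaled to trivial
  \<open>p\<close>-th power.\<close>

lemma complex_root_exists: "0 < n \<Longrightarrow> \<exists>w::complex. w ^ n = z"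
proof -
  assume n: "0 < n"
  have "rcis (root n (cmod z)) (Arg z / n) ^ n = rcis (cmod z) (Arg z)"
    using n by (simp add: DeMoivre2 real_root_pow_pos2)
  then show ?thesis by (metis rcis_cmod_Arg)
qed

context shifted_group
begin

text \<open>The normal form is read as a word in \<open>K\<close>. By collection, words in
  \<open>K\<close> multiply by the same rule as coordinates in \<open>graph_group\<close>, and
  reducing exponents modulo \<open>p\<close> is harmless by \<open>xp\<close> and
  \<open>yp\<close>.\<close>

lemma collecting_section:
  fixes K :: "('k, 'x) monoid_scheme"
  assumes "collecting K x y d edge_list"
    and xp: "\<And>i. i < d \<Longrightarrow> x i [^]\<^bsub>K\<^esub> p = \<one>\<^bsub>K\<^esub>"
    and yp: "\<And>e. e \<in> E \<Longrightarrow> y e [^]\<^bsub>K\<^esub> p = \<one>\<^bsub>K\<^esub>"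
    and \<pi>: "group_hom K H \<pi>" "\<And>i. i < d \<Longrightarrow> \<pi> (x i) = vtx i" "\<And>e. e \<in> E \<Longrightarrow> \<pi> (y e) = gen e"
  shows "\<exists>s \<in> hom H K. \<forall>g\<in>carrier H. \<pi> (s g) = g"
proof -
  interpret K: collecting K x y d edge_list by fact
  interpret \<pi>: group_hom K H \<pi> by fact
  let ?X = "\<lambda>v. K.xprod v [0..<d]"
  define s where "s g = ?X (\<lambda>i. co g (i, i)) \<otimes>\<^bsub>K\<^esub> K.yprod (co g)" for g
  have Xc: "?X v \<in> carrier K" for v by (rule K.xprod_closed) auto
  have Xmod: "?X (\<lambda>i. v i mod int p) = ?X v" for v
    using xp by (intro pow_prod_cong K.int_pow_mod) auto
  have Ymod: "K.yprod (\<lambda>e. w e mod int p) = K.yprod w" for w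
    using yp K.y_closed edge_list by (intro pow_prod_cong K.int_pow_mod) auto
  have "s (g \<otimes> h) = s g \<otimes>\<^bsub>K\<^esub> s h" if gh: "g \<in> carrier H" "h \<in> carrier H" for g h
  proof -
    let ?v = "\<lambda>i. co g (i, i)" and ?v' = "\<lambda>i. co h (i, i)"
    let ?c = "\<lambda>(i, j). if i \<in> set [0..<d] \<and> j \<in> set [0..<d] then ?v j * ?v' i else 0"
    have "s g \<otimes>\<^bsub>K\<^esub> s h = ?X ?v \<otimes>\<^bsub>K\<^esub> (K.yprod (co g) \<otimes>\<^bsub>K\<^esub> ?X ?v') \<otimes>\<^bsub>K\<^esub> K.yprod (co h)"
      unfolding s_def using Xc by (simp add: K.m_assoc)
    also have "K.yprod (co g) \<otimes>\<^bsub>K\<^esub> ?X ?v' = ?X ?v' \<otimes>\<^bsub>K\<^esub> K.yprod (co g)"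
      by (rule K.yprod_xprod) auto
    also have "?X ?v \<otimes>\<^bsub>K\<^esub> (?X ?v' \<otimes>\<^bsub>K\<^esub> K.yprod (co g)) \<otimes>\<^bsub>K\<^esub> K.yprod (co h)
        = (?X ?v \<otimes>\<^bsub>K\<^esub> ?X ?v') \<otimes>\<^bsub>K\<^esub> (K.yprod (co g) \<otimes>\<^bsub>K\<^esub> K.yprod (co h))"
      using Xc by (simp add: K.m_assoc)
    also have "?X ?v \<otimes>\<^bsub>K\<^esub> ?X ?v' = ?X (\<lambda>i. ?v i + ?v' i) \<otimes>\<^bsub>K\<^esub> K.yprod ?c"
      by (rule K.collect) (auto simp: sorted_wrt_upt)
    also have "?X (\<lambda>i. ?v i + ?v' i) \<otimes>\<^bsub>K\<^esub> K.yprod ?c \<otimes>\<^bsub>K\<^esub> (K.yprod (co g) \<otimes>\<^bsub>K\<^esub> K.yprod (co h))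
        = ?X (\<lambda>i. ?v i + ?v' i) \<otimes>\<^bsub>K\<^esub> K.yprod (\<lambda>e. ?c e + (co g e + co h e))"
      using Xc by (simp add: K.m_assoc K.yprod_add)
    also have "\<dots> = ?X (\<lambda>i. (?v i + ?v' i) mod int p)
        \<otimes>\<^bsub>K\<^esub> K.yprod (\<lambda>e. (?c e + (co g e + co h e)) mod int p)"
      by (simp only: Xmod Ymod)
    also have "?X (\<lambda>i. (?v i + ?v' i) mod int p) = ?X (\<lambda>i. co (g \<otimes> h) (i, i))"
      using gh by (intro pow_prod_cong) (auto simp: co_mult)
    also have "K.yprod (\<lambda>e. (?c e + (co g e + co h e)) mod int p) = K.yprod (co (g \<otimes> h))"
    proof (rule pow_prod_cong)
      fix e assume "e \<in> set edge_list"
      moreover obtain i j where "e = (i, j)" by force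
      ultimately have "(?c e + (co g e + co h e)) mod int p = co (g \<otimes> h) e"
        using gh E_less[of i j] E_less_d[of i j] by (auto simp: edge_list co_mult add_ac)
      then show "y e [^]\<^bsub>K\<^esub> ((?c e + (co g e + co h e)) mod int p) = y e [^]\<^bsub>K\<^esub> co (g \<otimes> h) e" by simp
    qed
    finally show ?thesis unfolding s_def by simp
  qed
  moreover have "s g \<in> carrier K" for g unfolding s_def using Xc by simp
  moreover have "\<pi> (s g) = g" if "g \<in> carrier H" for g
  proof -
    have "\<pi> (s g) = \<pi> (?X (\<lambda>i. co g (i, i))) \<otimes> \<pi> (K.yprod (co g))"
      unfolding s_def using Xc by simp
    also have "\<pi> (?X (\<lambda>i. co g (i, i))) = col.xprod (\<lambda>i. co g (i, i)) [0..<d]"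
      using \<pi>(2) by (subst \<pi>.hom_pow_prod) (auto intro: pow_prod_cong)
    also have "\<pi> (K.yprod (co g)) = col.yprod (co g)"
      using \<pi>(3) edge_list by (subst \<pi>.hom_pow_prod) (auto intro: pow_prod_cong)
    finally show ?thesis using normal_form[OF that] by simp
  qed
  ultimately show ?thesis by (intro bexI[of _ s]) (auto simp: hom_def)
qed

text \<open>Pairs of an edge \<open>e\<close> and a vertex \<open>c\<close> are left out for
  \<open>c < fst e\<close>, where a Hall-Witt argument reduces them to others, and for
  \<open>\<delta> \<le> c\<close>, where \<open>c\<close> is adjacent to neither end of
  \<open>e\<close>.\<close>

definition index :: "(nat \<times> nat + (nat \<times> nat) \<times> nat) set" where
  "index = {(i, j). i < j \<and> j < d \<and> (i, j) \<notin> E} <+> (SIGMA e:E. {fst e..<\<delta>})"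

fun lft rgt :: "nat \<times> nat + (nat \<times> nat) \<times> nat \<Rightarrow> 'a" where
  "lft (Inl (i, j)) = vtx i"
| "lft (Inr (e, c)) = gen e"
| "rgt (Inl (i, j)) = vtx j"
| "rgt (Inr (e, c)) = vtx c"

lemma index_simps:
  "Inl (i, j) \<in> index \<longleftrightarrow> i < j \<and> j < d \<and> (i, j) \<notin> E"
  "Inr ((a, b), c) \<in> index \<longleftrightarrow> (a, b) \<in> E \<and> a \<le> c \<and> c < \<delta>"
  by (auto simp: index_def)

lemma index_cases:
  assumes "\<iota> \<in> index"
  obtains (nonedge) i j where "\<iota> = Inl (i, j)" "i < j" "j < d" "i < d" "(i, j) \<notin> E"
  | (edge) a b c where "\<iota> = Inr ((a, b), c)" "(a, b) \<in> E" "a < b" "b < \<delta>" "a \<le> c" "c < \<delta>" "c < d"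
proof (cases \<iota>)
  case (Inl q)
  then show ?thesis using assms nonedge by (cases q) (auto simp: index_simps)
next
  case (Inr q)
  then obtain a b c where q: "q = ((a, b), c)" by (metis surj_pair)
  show ?thesis using assms edge[of a b c] E_less[of a b] \<delta>_le unfolding Inr q by (auto simp: index_simps)
qed

lemma lft_rgt:
  assumes "\<iota> \<in> index"
  shows "lft \<iota> \<in> carrier H" "rgt \<iota> \<in> carrier H" "lft \<iota> \<otimes> rgt \<iota> = rgt \<iota> \<otimes> lft \<iota>"
  using assms
proof (atomize (full), cases rule: index_cases)
  case (nonedge i j)
  then show "lft \<iota> \<in> carrier H \<and> rgt \<iota> \<in> carrier H \<and> lft \<iota> \<otimes> rgt \<iota> = rgt \<iota> \<otimes> lft \<iota>"
    using vtx_exchange[of i j] by simp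
next
  case (edge a b c)
  then show "lft \<iota> \<in> carrier H \<and> rgt \<iota> \<in> carrier H \<and> lft \<iota> \<otimes> rgt \<iota> = rgt \<iota> \<otimes> lft \<iota>"
    using col.yx[of "(a, b)" c] by (simp add: edge_list E_B)
qed

text \<open>In the central extension of \<open>H\<close> by \<open>\<complex>\<^sup>*\<close> lift the generators to elements of order \<open>p\<close>. The
  hypothesis makes their commutators central, so that collection yields a section.\<close>

lemma coboundary_if_symmetric:
  assumes f: "f \<in> cocycles2 H" and f1: "f \<one> \<one> = 1"
    and sym: "\<And>\<iota>. \<iota> \<in> index \<Longrightarrow> f (lft \<iota>) (rgt \<iota>) = f (rgt \<iota>) (lft \<iota>)"
  shows "\<exists>c. (\<forall>x\<in>carrier H. c x \<noteq> 0) \<and> (\<forall>x\<in>carrier H. \<forall>y\<in>carrier H. f x y = c x * c y / c (x \<otimes> y))"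
proof -
  have fnz: "f x y \<noteq> 0" if "x \<in> carrier H" "y \<in> carrier H" for x y
    using f that by (auto simp: cocycles2_def)
  have fc: "f x y * f (x \<otimes> y) z = f y z * f x (y \<otimes> z)"
    if "x \<in> carrier H" "y \<in> carrier H" "z \<in> carrier H" for x y z
    using f that by (auto simp: cocycles2_def)
  interpret A: comm_group units_complex by (rule comm_group_units_complex)
  interpret X: central_extension units_complex H f
  proof unfold_locales
    fix x assume x: "x \<in> carrier H"
    show "f \<one> x = \<one>\<^bsub>units_complex\<^esub>" using fc[of \<one> \<one> x] fnz[of \<one> x] x f1 by (simp add: units_complex_def)
    show "f x \<one> = \<one>\<^bsub>units_complex\<^esub>" using fc[of x \<one> \<one>] fnz[of x \<one>] x f1 by (simp add: units_complex_def)
  qed (use fnz fc in \<open>auto simp: units_complex_def\<close>)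
  let ?K = "central_ext units_complex H f"
  interpret K: group ?K by (rule X.group_Ext)
  interpret \<pi>: group_hom ?K H snd by (rule X.snd_hom)
  have Kc: "u \<in> carrier ?K \<longleftrightarrow> fst u \<noteq> 0 \<and> snd u \<in> carrier H" for u
    unfolding X.Ext_carrier by (cases u) (auto simp: units_complex_def)
  have Km: "(a, x) \<otimes>\<^bsub>?K\<^esub> (b, y) = (a * b * f x y, x \<otimes> y)" for a b x y
    unfolding X.Ext_mult by (simp add: units_complex_def)
  have K1: "\<one>\<^bsub>?K\<^esub> = (1, \<one>)" unfolding X.Ext_one by (simp add: units_complex_def)
  have Ac: "a \<in> carrier units_complex \<longleftrightarrow> a \<noteq> 0" for a by (simp add: units_complex_def)
  have comm: "u \<otimes>\<^bsub>?K\<^esub> v = v \<otimes>\<^bsub>?K\<^esub> u \<longleftrightarrow> snd u \<otimes> snd v = snd v \<otimes> snd u \<and> f (snd u) (snd v) = f (snd v) (snd u)"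
    if "u \<in> carrier ?K" "v \<in> carrier ?K" for u v
    using X.Ext_commute_iff[of "fst u" "fst v" "snd u" "snd v"] that
    by (simp add: Kc Ac)
  \<comment> \<open>The \<open>p\<close>-th power of a lift of \<open>vtx i\<close> lies in the
    central kernel; scaling the lift by a \<open>p\<close>-th root of the inverse makes this power
    trivial.\<close>
  have "\<exists>u\<in>carrier ?K. snd u = vtx i \<and> u [^]\<^bsub>?K\<^esub> p = \<one>\<^bsub>?K\<^esub>" if i: "i < d" for i
  proof -
    have u: "(1, vtx i) \<in> carrier ?K" using i by (simp add: Kc)
    then have "snd ((1, vtx i) [^]\<^bsub>?K\<^esub> p) = \<one>" using i by (simp add: \<pi>.hom_nat_pow pow_p)
    then obtain \<beta> where \<beta>: "(1, vtx i) [^]\<^bsub>?K\<^esub> p = (\<beta>, \<one>)" by (metis prod.collapse)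
    then have "\<beta> \<noteq> 0" using K.nat_pow_closed[OF u, of p] by (simp add: Kc)
    obtain \<gamma> where \<gamma>: "\<gamma> ^ p = 1 / \<beta>" using complex_root_exists[of p "1 / \<beta>"] p_gt1 by auto
    have "\<gamma> \<noteq> 0" using \<gamma> \<open>\<beta> \<noteq> 0\<close> p_gt1 by (metis divide_eq_0_iff not_one_less_zero zero_neq_one zero_power2 power_0_left)
    then have g: "(\<gamma>, \<one>) \<in> carrier ?K" by (simp add: Kc)
    have gn: "(\<gamma>, \<one>) [^]\<^bsub>?K\<^esub> n = (\<gamma> ^ n, \<one>)" for n :: nat
      by (induction n) (simp_all add: Km f1 K1 mult.commute)
    have "(\<gamma>, \<one>) \<otimes>\<^bsub>?K\<^esub> (1, vtx i) = (1, vtx i) \<otimes>\<^bsub>?K\<^esub> (\<gamma>, \<one>)"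
      using comm[OF g u] i X.f_one_left X.f_one_right by simp
    then have "((\<gamma>, \<one>) \<otimes>\<^bsub>?K\<^esub> (1, vtx i)) [^]\<^bsub>?K\<^esub> p = (\<gamma> ^ p, \<one>) \<otimes>\<^bsub>?K\<^esub> (\<beta>, \<one>)"
      using K.pow_mult_distrib[OF _ g u, of p] by (simp add: gn \<beta>)
    also have "\<dots> = \<one>\<^bsub>?K\<^esub>" using \<gamma> \<open>\<beta> \<noteq> 0\<close> by (simp add: Km f1 K1)
    finally show ?thesis using i by (intro bexI[OF _ K.m_closed[OF g u]]) (simp add: Km)
  qed
  then obtain x where x: "\<And>i. i < d \<Longrightarrow> x i \<in> carrier ?K" "\<And>i. i < d \<Longrightarrow> snd (x i) = vtx i"
    "\<And>i. i < d \<Longrightarrow> x i [^]\<^bsub>?K\<^esub> p = \<one>\<^bsub>?K\<^esub>"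
    by metis
  \<comment> \<open>Commutators of lifts are formed for all pairs, not only edges: over edges they
    lift \<open>gen e\<close>, and for increasing nonadjacent pairs they are trivial. The Hall-Witt
    step then needs no case distinction.\<close>
  define y where "y = (\<lambda>(i, j). inv\<^bsub>?K\<^esub> (x i \<otimes>\<^bsub>?K\<^esub> x j) \<otimes>\<^bsub>?K\<^esub> (x j \<otimes>\<^bsub>?K\<^esub> x i))"
  have yc: "y (i, j) \<in> carrier ?K" if "i < d" "j < d" for i j using that x by (simp add: y_def)
  have ycE: "y e \<in> carrier ?K" if "e \<in> E" for e using that yc E_less_d by (cases e) auto
  have xy: "x j \<otimes>\<^bsub>?K\<^esub> x i = x i \<otimes>\<^bsub>?K\<^esub> x j \<otimes>\<^bsub>?K\<^esub> y (i, j)" if "i < d" "j < d" for i j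
    using that x by (simp add: y_def K.m_assoc[symmetric])
  have xx: "x j \<otimes>\<^bsub>?K\<^esub> x i = x i \<otimes>\<^bsub>?K\<^esub> x j" if "i < j" "j < d" "(i, j) \<notin> E" for i j
    using that x comm[of "x j" "x i"] vtx_exchange[of i j] sym[of "Inl (i, j)"] by (simp add: index_simps)
  have sy: "snd (y e) = gen e" if "e \<in> E" for e
  proof -
    obtain i j where e: "e = (i, j)" by force
    have ij: "i < j" "i < d" "j < d" using that E_less[of i j] E_less_d[of i j] by (auto simp: e)
    have "snd (y e) = inv (vtx i \<otimes> vtx j) \<otimes> (vtx j \<otimes> vtx i)"
      using ij x by (simp add: e y_def)
    also have "vtx j \<otimes> vtx i = vtx i \<otimes> vtx j \<otimes> gen e"
      using vtx_exchange[of i j] that ij by (simp add: e)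
    finally show ?thesis using ij that by (simp add: E_B inv_mult_cancel)
  qed
  have y_word: "u \<otimes>\<^bsub>?K\<^esub> y (a, b) = y (a, b) \<otimes>\<^bsub>?K\<^esub> u"
    if "u \<in> carrier ?K" "a < d" "b < d" "u \<otimes>\<^bsub>?K\<^esub> x a = x a \<otimes>\<^bsub>?K\<^esub> u" "u \<otimes>\<^bsub>?K\<^esub> x b = x b \<otimes>\<^bsub>?K\<^esub> u" for u a b
    unfolding y_def prod.case using that x by (intro K.commute_mult K.commute_inv) auto
  have yx1: "y (a, b) \<otimes>\<^bsub>?K\<^esub> x c = x c \<otimes>\<^bsub>?K\<^esub> y (a, b)"
    if "(a, b) \<in> E" "a \<le> c" "c < \<delta>" for a b c
  proof -
    have i: "Inr ((a, b), c) \<in> index" using that by (simp add: index_simps)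
    have "c < d" using that \<delta>_le by simp
    then show ?thesis
      using comm[OF ycE[OF that(1)] x(1)] sy[OF that(1)] x(2) lft_rgt(3)[OF i] sym[OF i] by simp
  qed
  have yx2: "y (i, j) \<otimes>\<^bsub>?K\<^esub> x c = x c \<otimes>\<^bsub>?K\<^esub> y (i, j)"
    if "i < j" "j < d" "i \<le> c" "c < \<delta>" for i j c
  proof (cases "(i, j) \<in> E")
    case False
    then have "y (i, j) = \<one>\<^bsub>?K\<^esub>" using that x xx[of i j] by (simp add: y_def)
    then show ?thesis using that x \<delta>_le by simp
  qed (use that yx1 in auto)
  have yx: "y e \<otimes>\<^bsub>?K\<^esub> x c = x c \<otimes>\<^bsub>?K\<^esub> y e" if e: "e \<in> E" and c: "c < d" for e c
  proof -
    obtain a b where e: "e = (a, b)" "(a, b) \<in> E" using e by (cases e) auto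
    have ab: "a < b" "b < \<delta>" "a < d" "b < d" using e E_less[of a b] E_less_d[of a b] by auto
    consider "a \<le> c" "c < \<delta>" | "\<delta> \<le> c" | "c < a" by linarith
    then show ?thesis
    proof cases
      case 1
      then show ?thesis using e yx1 by simp
    next
      case 2
      \<comment> \<open>No edge meets a vertex from \<open>\<delta>\<close> on, so
        \<open>x c\<close> commutes with \<open>x a\<close> and \<open>x b\<close>, and hence with
        their commutator.\<close>
      then have "(a, c) \<notin> E" "(b, c) \<notin> E" using E_less by (meson leD)+
      then have "x c \<otimes>\<^bsub>?K\<^esub> y (a, b) = y (a, b) \<otimes>\<^bsub>?K\<^esub> x c"
        using 2 ab c x xx[of a c] xx[of b c] by (intro y_word) auto
      then show ?thesis by (simp add: e)
    next
      case 3
      \<comment> \<open>Here \<open>c\<close> is the least of the three vertices, so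
        \<open>yx2\<close> makes \<open>y (c, a)\<close> and \<open>y (c, b)\<close> commute with
        the lifts \<open>x a\<close> and \<open>x b\<close>; these are the factors by which
        conjugation by \<open>x c\<close> changes \<open>x a\<close> and \<open>x b\<close>.\<close>
      have k: "y (c, a) \<in> carrier ?K" "y (c, b) \<in> carrier ?K" using yc 3 ab by auto
      have kx: "y (c, a) \<otimes>\<^bsub>?K\<^esub> x b = x b \<otimes>\<^bsub>?K\<^esub> y (c, a)" "y (c, a) \<otimes>\<^bsub>?K\<^esub> x a = x a \<otimes>\<^bsub>?K\<^esub> y (c, a)"
        "y (c, a) \<otimes>\<^bsub>?K\<^esub> x c = x c \<otimes>\<^bsub>?K\<^esub> y (c, a)"
        "y (c, b) \<otimes>\<^bsub>?K\<^esub> x b = x b \<otimes>\<^bsub>?K\<^esub> y (c, b)" "y (c, b) \<otimes>\<^bsub>?K\<^esub> x a = x a \<otimes>\<^bsub>?K\<^esub> y (c, b)"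
        using 3 ab by (auto intro!: yx2)
      have kl: "y (c, a) \<otimes>\<^bsub>?K\<^esub> y (c, b) = y (c, b) \<otimes>\<^bsub>?K\<^esub> y (c, a)"
        using 3 ab k kx by (intro y_word) auto
      show ?thesis
        unfolding e y_def prod.case
        by (rule K.commutator_centralised[OF x(1)[OF ab(4)] x(1)[OF ab(3)] x(1)[OF c] k
              xy[OF c ab(3)] xy[OF c ab(4)] kx(1,2,4,5) kl])
    qed
  qed
  have "collecting ?K x y d edge_list"
  proof
    fix e e' assume "e \<in> set edge_list" "e' \<in> set edge_list"
    moreover obtain a b where e': "e' = (a, b)" by force
    ultimately have e: "e \<in> E" and ab: "a < d" "b < d" using E_less_d[of a b] by (auto simp: edge_list)
    show "y e \<otimes>\<^bsub>?K\<^esub> y e' = y e' \<otimes>\<^bsub>?K\<^esub> y e"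
      unfolding e' by (rule y_word[OF ycE[OF e] ab yx[OF e ab(1)] yx[OF e ab(2)]])
  next
    fix i j assume "i < j" "j < d"
    then show "x j \<otimes>\<^bsub>?K\<^esub> x i = (if (i, j) \<in> set edge_list then x i \<otimes>\<^bsub>?K\<^esub> x j \<otimes>\<^bsub>?K\<^esub> y (i, j) else x i \<otimes>\<^bsub>?K\<^esub> x j)"
      using xx[of i j] xy[of i j] by (simp add: edge_list)
  next
    show "y e \<otimes>\<^bsub>?K\<^esub> x c = x c \<otimes>\<^bsub>?K\<^esub> y e" if "e \<in> set edge_list" "c < d" for e c
      using that by (intro yx) (simp_all add: edge_list)
  qed (use edge_list E_less_d x ycE in \<open>simp_all add: E_less\<close>)
  moreover have "y e [^]\<^bsub>?K\<^esub> p = \<one>\<^bsub>?K\<^esub>" if "e \<in> E" for e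
  proof -
    obtain i j where e: "e = (i, j)" by force
    have ij: "i < d" "j < d" using that E_less_d[of i j] by (auto simp: e)
    \<comment> \<open>Moving \<open>x j [^] p = \<one>\<close> past \<open>x i\<close> leaves
      \<open>y e [^] p\<close>, which must therefore be trivial.\<close>
    have "x j [^]\<^bsub>?K\<^esub> int p \<otimes>\<^bsub>?K\<^esub> x i = x i \<otimes>\<^bsub>?K\<^esub> x j [^]\<^bsub>?K\<^esub> int p \<otimes>\<^bsub>?K\<^esub> y e [^]\<^bsub>?K\<^esub> int p"
      by (rule K.int_pow_exchange_one[OF x(1)[OF ij(1)] x(1)[OF ij(2)] ycE[OF that] _ yx[OF that ij(2), symmetric]])
        (simp only: e xy[OF ij])
    then have "x i \<otimes>\<^bsub>?K\<^esub> y e [^]\<^bsub>?K\<^esub> p = x i" using ij x by (simp add: int_pow_int)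
    then show ?thesis using x(1)[OF ij(1)] K.nat_pow_closed[OF ycE[OF that]] by simp
  qed
  ultimately obtain s where s: "s \<in> hom H ?K" "\<And>g. g \<in> carrier H \<Longrightarrow> snd (s g) = g"
    using collecting_section[of ?K x y snd] x sy X.snd_hom by metis
  \<comment> \<open>The section \<open>s\<close> is multiplicative, so its central components
    trivialise \<open>f\<close> up to inversion; the reciprocal gives the required
    direction.\<close>
  define c where "c g = 1 / fst (s g)" for g
  have nz: "fst (s g) \<noteq> 0" if "g \<in> carrier H" for g
    using s(1) that Kc by (auto simp: hom_def Pi_iff)
  have "f g h = c g * c h / c (g \<otimes> h)" if gh: "g \<in> carrier H" "h \<in> carrier H" for g h
  proof -
    have "s (g \<otimes> h) = (fst (s g), g) \<otimes>\<^bsub>?K\<^esub> (fst (s h), h)"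
      using s gh by (metis hom_mult prod.collapse)
    then have "fst (s (g \<otimes> h)) = fst (s g) * fst (s h) * f g h" by (simp add: Km)
    then show ?thesis using nz gh by (simp add: c_def)
  qed
  then show ?thesis using nz by (intro exI[of _ c]) (auto simp: c_def)
qed

end

section \<open>The Schur multiplier\<close>

lemma cocycles2D:
  assumes "f \<in> cocycles2 G" "x \<in> carrier G" "y \<in> carrier G"
  shows "f x y \<noteq> 0"
    and "z \<in> carrier G \<Longrightarrow> f x y * f (x \<otimes>\<^bsub>G\<^esub> y) z = f y z * f x (y \<otimes>\<^bsub>G\<^esub> z)"
  using assms by (auto simp: cocycles2_def)

section \<open>Commutators of lifts as invariants of cocycle classes\<close>

definition commutator_value :: "('a \<Rightarrow> 'a \<Rightarrow> complex) \<Rightarrow> 'a \<Rightarrow> 'a \<Rightarrow> complex" where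
  "commutator_value f x y = f x y / f y x"

context group
begin

text \<open>Three instances of the cocycle identity move \<open>v\<close> through the product of
  \<open>u\<close> and \<open>u'\<close>, first past \<open>u'\<close> and then past
  \<open>u\<close>; the remaining factors cancel.\<close>

lemma commutator_value_mult:
  assumes f: "f \<in> cocycles2 G" and cl: "u \<in> carrier G" "u' \<in> carrier G" "v \<in> carrier G"
    and uv: "u \<otimes> v = v \<otimes> u" and u'v: "u' \<otimes> v = v \<otimes> u'"
  shows "commutator_value f (u \<otimes> u') v = commutator_value f u v * commutator_value f u' v"
proof -
  note nz = cocycles2D(1)[OF f]
  note fc = cocycles2D(2)[OF f]
  have 1: "f u u' * f (u \<otimes> u') v = f u' v * f u (v \<otimes> u')" using fc[of u u' v] cl u'v by simp
  have 2: "f u v * f (v \<otimes> u) u' = f v u' * f u (v \<otimes> u')" using fc[of u v u'] cl uv by simp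
  have 3: "f v u * f (v \<otimes> u) u' = f u u' * f v (u \<otimes> u')" using fc[of v u u'] cl by simp
  have n: "f u u' \<noteq> 0" "f v u' \<noteq> 0" "f v u \<noteq> 0" "f (v \<otimes> u) u' \<noteq> 0" "f v (u \<otimes> u') \<noteq> 0" "f u (v \<otimes> u') \<noteq> 0"
    using nz cl by auto
  have "f u u' * f (u \<otimes> u') v * (f v u * f v u') = f u' v * f v u * (f v u' * f u (v \<otimes> u'))"
    using 1 by (simp add: mult_ac)
  also have "\<dots> = f u' v * f u v * (f v u * f (v \<otimes> u) u')" using 2 by (simp add: mult_ac)
  also have "\<dots> = f u u' * (f u v * f u' v * f v (u \<otimes> u'))" using 3 by (simp add: mult_ac)
  finally have "f (u \<otimes> u') v * (f v u * f v u') = f u v * f u' v * f v (u \<otimes> u')"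
    using n by simp
  then show ?thesis using n by (simp add: commutator_value_def field_simps)
qed

lemma commutator_value_one:
  assumes "f \<in> cocycles2 G" "v \<in> carrier G"
  shows "commutator_value f \<one> v = 1"
  using cocycles2D[OF assms(1), of \<one> \<one>] cocycles2D(2)[OF assms(1), of \<one> \<one> v]
    cocycles2D(2)[OF assms(1), of v \<one> \<one>] cocycles2D(1)[OF assms(1)] assms(2)
  by (simp add: commutator_value_def)

lemma commutator_value_pow:
  assumes f: "f \<in> cocycles2 G" and cl: "u \<in> carrier G" "v \<in> carrier G" and uv: "u \<otimes> v = v \<otimes> u"
  shows "commutator_value f (u [^] (n::nat)) v = commutator_value f u v ^ n"
proof (induction n)
  case (Suc n)
  then show ?case
    using commutator_value_mult[OF f _ cl(1,2) _ uv, of "u [^] n"] cl uv group_commutes_pow[OF uv cl]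
    by (simp add: mult.commute)
qed (use commutator_value_one[OF f cl(2)] in simp)

text \<open>The coboundary factor is symmetric at a commuting pair and cancels in the
  quotient.\<close>

lemma commutator_value_cohomologous:
  assumes "(f, g) \<in> cohomologous G" "u \<in> carrier G" "v \<in> carrier G" "u \<otimes> v = v \<otimes> u"
  shows "commutator_value f u v = commutator_value g u v"
proof -
  obtain c where c: "\<And>x. x \<in> carrier G \<Longrightarrow> c x \<noteq> 0"
    "\<And>x y. x \<in> carrier G \<Longrightarrow> y \<in> carrier G \<Longrightarrow> f x y = g x y * (c x * c y / c (x \<otimes> y))"
    using assms(1) by (auto simp: cohomologous_def)
  have "c u * c v / c (u \<otimes> v) \<noteq> 0" using c(1) assms by simp
  then show ?thesis
    unfolding commutator_value_def using c(2) assms by (simp add: mult.commute)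
qed

end

section \<open>Cocycles with values in the \<open>p\<close>-th roots of unity\<close>

definition unit_root :: "nat \<Rightarrow> int \<Rightarrow> complex" where
  "unit_root p n = cis (2 * pi * real_of_int n / real p)"

lemma unit_root_0 [simp]: "unit_root p 0 = 1"
  and unit_root_nonzero [simp]: "unit_root p n \<noteq> 0"
  and unit_root_add: "unit_root p (m + n) = unit_root p m * unit_root p n"
  and unit_root_diff: "unit_root p (m - n) = unit_root p m / unit_root p n"
  by (simp_all add: unit_root_def cis_mult cis_divide add_divide_distrib diff_divide_distrib algebra_simps)

lemma unit_root_mod:
  assumes "0 < p"
  shows "unit_root p (n mod int p) = unit_root p n"
proof -
  have "unit_root p (int p * k) = 1" for k
  proof -
    have "unit_root p (int p * k) = cis (2 * pi * real_of_int k)"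
      using assms by (simp add: unit_root_def mult.assoc)
    then show ?thesis by (simp add: cis_multiple_2pi)
  qed
  then have "unit_root p (int p * (n div int p)) * unit_root p (n mod int p) = unit_root p (n mod int p)"
    by simp
  then show ?thesis by (simp flip: unit_root_add)
qed

lemma unit_root_bij: "0 < p \<Longrightarrow> bij_betw (unit_root p \<circ> int) {..<p} {z. z ^ p = 1}"
  using bij_betw_roots_unity[of p] by (simp add: unit_root_def comp_def)

lemma unit_root_eq_iff:
  assumes "0 < p"
  shows "unit_root p m = unit_root p n \<longleftrightarrow> m mod int p = n mod int p"
proof
  assume "unit_root p m = unit_root p n"
  moreover have *: "unit_root p k = (unit_root p \<circ> int) (nat (k mod int p))" for k
    using assms by (simp add: unit_root_mod)
  moreover have "nat (k mod int p) \<in> {..<p}" for k using assms by (simp add: nat_less_iff)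
  ultimately have "nat (m mod int p) = nat (n mod int p)"
    using unit_root_bij[OF assms] unfolding bij_betw_def inj_on_def by metis
  then show "m mod int p = n mod int p" using assms by (metis nat_eq_iff2 pos_mod_sign of_nat_0_less_iff)
qed (metis assms unit_root_mod)

lemma unit_root_power: "0 < p \<Longrightarrow> unit_root p n ^ p = 1"
  by (simp add: unit_root_def DeMoivre cis_multiple_2pi)

text \<open>Integer-valued functions that satisfy the cocycle identity modulo \<open>p\<close>; composing them with
  \<^const>\<open>unit_root\<close> gives elements of \<^const>\<open>cocycles2\<close>.\<close>

definition mod_cocycle :: "nat \<Rightarrow> ('a, 'b) monoid_scheme \<Rightarrow> ('a \<Rightarrow> 'a \<Rightarrow> int) \<Rightarrow> bool" where
  "mod_cocycle p G P \<longleftrightarrow> (\<forall>x\<in>carrier G. \<forall>y\<in>carrier G. \<forall>z\<in>carrier G.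
     (P x y + P (x \<otimes>\<^bsub>G\<^esub> y) z) mod int p = (P y z + P x (y \<otimes>\<^bsub>G\<^esub> z)) mod int p)"

lemma mod_cocycle_sum:
  assumes "\<And>i. i \<in> I \<Longrightarrow> mod_cocycle p G (P i)"
  shows "mod_cocycle p G (\<lambda>x y. \<Sum>i\<in>I. n i * P i x y)"
proof (cases "finite I")
  case True
  show ?thesis
    unfolding mod_cocycle_def
  proof (intro ballI)
    fix x y z assume xyz: "x \<in> carrier G" "y \<in> carrier G" "z \<in> carrier G"
    have "int p dvd (P i x y + P i (x \<otimes>\<^bsub>G\<^esub> y) z) - (P i y z + P i x (y \<otimes>\<^bsub>G\<^esub> z))" if "i \<in> I" for i
      using assms[OF that] xyz by (simp add: mod_cocycle_def mod_eq_dvd_iff)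
    then have "int p dvd (\<Sum>i\<in>I. n i * ((P i x y + P i (x \<otimes>\<^bsub>G\<^esub> y) z) - (P i y z + P i x (y \<otimes>\<^bsub>G\<^esub> z))))"
      by (intro dvd_sum) simp
    also have "(\<Sum>i\<in>I. n i * ((P i x y + P i (x \<otimes>\<^bsub>G\<^esub> y) z) - (P i y z + P i x (y \<otimes>\<^bsub>G\<^esub> z))))
      = ((\<Sum>i\<in>I. n i * P i x y) + (\<Sum>i\<in>I. n i * P i (x \<otimes>\<^bsub>G\<^esub> y) z))
        - ((\<Sum>i\<in>I. n i * P i y z) + (\<Sum>i\<in>I. n i * P i x (y \<otimes>\<^bsub>G\<^esub> z)))"
      by (simp add: sum.distrib sum_subtractf algebra_simps)
    finally show "((\<Sum>i\<in>I. n i * P i x y) + (\<Sum>i\<in>I. n i * P i (x \<otimes>\<^bsub>G\<^esub> y) z)) mod int p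
       = ((\<Sum>i\<in>I. n i * P i y z) + (\<Sum>i\<in>I. n i * P i x (y \<otimes>\<^bsub>G\<^esub> z))) mod int p"
      by (simp add: mod_eq_dvd_iff)
  qed
qed (simp add: mod_cocycle_def)

lemma mod_cocycle_uminus: "mod_cocycle p G P \<Longrightarrow> mod_cocycle p G (\<lambda>x y. - P x y)"
  using mod_cocycle_sum[of "{()}" p G "\<lambda>_. P" "\<lambda>_. -1"] by simp

text \<open>The Massey product of three 1-cocycles.\<close>

lemma mod_cocycle_massey:
  assumes add: "\<And>x y. x \<in> carrier G \<Longrightarrow> y \<in> carrier G \<Longrightarrow> a (x \<otimes>\<^bsub>G\<^esub> y) mod int p = (a x + a y) mod int p"
      "\<And>x y. x \<in> carrier G \<Longrightarrow> y \<in> carrier G \<Longrightarrow> c (x \<otimes>\<^bsub>G\<^esub> y) mod int p = (c x + c y) mod int p"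
    and u: "\<And>x y. x \<in> carrier G \<Longrightarrow> y \<in> carrier G \<Longrightarrow>
      u (x \<otimes>\<^bsub>G\<^esub> y) mod int p = (u x + u y + a x * b y) mod int p"
    and v: "\<And>x y. x \<in> carrier G \<Longrightarrow> y \<in> carrier G \<Longrightarrow>
      v (x \<otimes>\<^bsub>G\<^esub> y) mod int p = (v x + v y + b x * c y) mod int p"
  shows "mod_cocycle p G (\<lambda>x y. u x * c y + a x * v y)"
  unfolding mod_cocycle_def
proof (intro ballI)
  fix x y z assume xyz: "x \<in> carrier G" "y \<in> carrier G" "z \<in> carrier G"
  have m: "(k * s) mod int p = (k * t) mod int p" if "s mod int p = t mod int p" for k s t
    using that by (metis mod_mult_right_eq)
  have "(u x * c y + a x * v y + (c z * u (x \<otimes>\<^bsub>G\<^esub> y) + v z * a (x \<otimes>\<^bsub>G\<^esub> y))) mod int p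
     = (u x * c y + a x * v y + (c z * (u x + u y + a x * b y) + v z * (a x + a y))) mod int p"
    using xyz by (intro mod_add_cong m refl u add)
  \<comment> \<open>The triple term \<open>a x * b y * c z\<close> comes from the coboundary of
    \<open>u\<close> on one side and from that of \<open>v\<close> on the other.\<close>
  also have "\<dots> = (u y * c z + a y * v z + (u x * (c y + c z) + a x * (v y + v z + b y * c z))) mod int p"
    by (simp add: algebra_simps)
  also have "\<dots> = (u y * c z + a y * v z + (u x * c (y \<otimes>\<^bsub>G\<^esub> z) + a x * v (y \<otimes>\<^bsub>G\<^esub> z))) mod int p"
    using xyz by (intro mod_add_cong m refl v[symmetric] add[symmetric])
  finally show "(u x * c y + a x * v y + (u (x \<otimes>\<^bsub>G\<^esub> y) * c z + a (x \<otimes>\<^bsub>G\<^esub> y) * v z)) mod int p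
     = (u y * c z + a y * v z + (u x * c (y \<otimes>\<^bsub>G\<^esub> z) + a x * v (y \<otimes>\<^bsub>G\<^esub> z))) mod int p"
    by (simp add: mult.commute)
qed

lemma unit_root_cocycle:
  assumes "mod_cocycle p G P" "0 < p"
  shows "x \<in> carrier G \<Longrightarrow> y \<in> carrier G \<Longrightarrow> z \<in> carrier G \<Longrightarrow>
    unit_root p (P x y) * unit_root p (P (x \<otimes>\<^bsub>G\<^esub> y) z) = unit_root p (P y z) * unit_root p (P x (y \<otimes>\<^bsub>G\<^esub> z))"
  using assms by (simp add: mod_cocycle_def unit_root_eq_iff flip: unit_root_add)

definition unit_root_cochain where
  "unit_root_cochain p G P = (\<lambda>x y. if x \<in> carrier G \<and> y \<in> carrier G then unit_root p (P x y) else 1)"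

lemma (in group) unit_root_cochain:
  assumes "mod_cocycle p G P" "0 < p"
  shows "unit_root_cochain p G P \<in> cocycles2 G"
  using unit_root_cocycle[OF assms] by (auto simp: cocycles2_def unit_root_cochain_def)

text \<open>The classes are the nonempty fibres of \<open>\<phi>\<close>, one for each
  value.\<close>

lemma card_kernel_quotient:
  assumes "\<And>f g. (f, g) \<in> R \<longleftrightarrow> f \<in> Z \<and> g \<in> Z \<and> \<phi> f = \<phi> g"
  shows "card (Z // R) = card (\<phi> ` Z)"
proof -
  let ?h = "\<lambda>v. {g \<in> Z. \<phi> g = v}"
  have "R `` {f} = ?h (\<phi> f)" if "f \<in> Z" for f
    using that by (auto simp: assms)
  then have "Z // R = ?h ` \<phi> ` Z"
    unfolding quotient_def by (simp add: image_image UNION_singleton_eq_range)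
  moreover have "inj_on ?h (\<phi> ` Z)" by (auto simp: inj_on_def)
  ultimately show ?thesis by (simp add: card_image)
qed

section \<open>The dual basis of cocycles and the order of the multiplier\<close>

context shifted_group
begin

text \<open>For the converse, the quotient of \<open>f\<close> and \<open>g\<close> is symmetric at
  all index pairs, so after normalisation it is a coboundary.\<close>

lemma cohomologous_iff:
  "(f, g) \<in> cohomologous H \<longleftrightarrow> f \<in> cocycles2 H \<and> g \<in> cocycles2 H \<and>
    (\<forall>\<iota>\<in>index. commutator_value f (lft \<iota>) (rgt \<iota>) = commutator_value g (lft \<iota>) (rgt \<iota>))"
  (is "_ \<longleftrightarrow> ?R")
proof
  assume "(f, g) \<in> cohomologous H"
  then show ?R using commutator_value_cohomologous lft_rgt by (auto simp: cohomologous_def)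
next
  assume ?R
  then have f: "f \<in> cocycles2 H" and g: "g \<in> cocycles2 H"
    and eq: "\<And>\<iota>. \<iota> \<in> index \<Longrightarrow> f (lft \<iota>) (rgt \<iota>) / f (rgt \<iota>) (lft \<iota>) = g (lft \<iota>) (rgt \<iota>) / g (rgt \<iota>) (lft \<iota>)"
    by (auto simp: commutator_value_def)
  note fD = cocycles2D[OF f] and gD = cocycles2D[OF g]
  \<comment> \<open>Dividing by \<open>q\<close> gives the value 1 at the unit that the splitting
    lemma requires. The constant is itself the coboundary of a constant cochain and returns at the
    end as the factor in \<open>q * c x\<close>.\<close>
  define q where "q = f \<one> \<one> / g \<one> \<one>"
  have q: "q \<noteq> 0" using fD gD by (simp add: q_def)
  define h where "h = (\<lambda>x y. if x \<in> carrier H \<and> y \<in> carrier H then f x y / g x y / q else 1)"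
  have "h \<in> cocycles2 H"
    unfolding cocycles2_def
  proof (intro CollectI conjI ballI allI impI)
    fix x y z assume xyz: "x \<in> carrier H" "y \<in> carrier H" "z \<in> carrier H"
    have "(f x y * f (x \<otimes> y) z) / (g x y * g (x \<otimes> y) z) = (f y z * f x (y \<otimes> z)) / (g y z * g x (y \<otimes> z))"
      using xyz fD(2)[of x y z] gD(2)[of x y z] by simp
    from arg_cong[OF this, of "\<lambda>r. r / (q * q)"]
    show "h x y * h (x \<otimes> y) z = h y z * h x (y \<otimes> z)"
      using xyz by (simp add: h_def mult_ac)
  qed (use fD gD q in \<open>auto simp: h_def\<close>)
  moreover have "h \<one> \<one> = 1" using q by (simp add: h_def q_def)
  moreover have "h (lft \<iota>) (rgt \<iota>) = h (rgt \<iota>) (lft \<iota>)" if "\<iota> \<in> index" for \<iota>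
  proof -
    have "f (lft \<iota>) (rgt \<iota>) / g (lft \<iota>) (rgt \<iota>) = f (rgt \<iota>) (lft \<iota>) / g (rgt \<iota>) (lft \<iota>)"
      using eq[OF that] lft_rgt(1,2)[OF that] fD(1) gD(1) by (simp add: frac_eq_eq mult.commute)
    then show ?thesis using lft_rgt(1,2)[OF that] by (simp add: h_def)
  qed
  ultimately obtain c where c: "\<And>x. x \<in> carrier H \<Longrightarrow> c x \<noteq> 0"
      "\<And>x y. x \<in> carrier H \<Longrightarrow> y \<in> carrier H \<Longrightarrow> h x y = c x * c y / c (x \<otimes> y)"
    using coboundary_if_symmetric[of h] by blast
  have "f x y = g x y * (q * c x * (q * c y) / (q * c (x \<otimes> y)))" if "x \<in> carrier H" "y \<in> carrier H" for x y
  proof -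
    have "f x y = g x y * q * h x y" using that q gD(1) by (simp add: h_def)
    then show ?thesis using c(2)[OF that] q by simp
  qed
  then show "(f, g) \<in> cohomologous H"
    unfolding cohomologous_def using f g c(1) q by (auto intro!: exI[of _ "\<lambda>x. q * c x"])
qed

text \<open>The value is multiplicative in its left argument, whose \<open>p\<close>-th power is
  trivial.\<close>

lemma commutator_value_root:
  assumes "f \<in> cocycles2 H" "\<iota> \<in> index"
  shows "commutator_value f (lft \<iota>) (rgt \<iota>) ^ p = 1"
  using commutator_value_pow[OF assms(1) lft_rgt[OF assms(2)], of p] pow_p[OF lft_rgt(1)[OF assms(2)]]
    commutator_value_one[OF assms(1) lft_rgt(2)[OF assms(2)]] by simp

text \<open>\<open>primitive i j\<close> is a 1-cochain whose coboundary is the cup product of the coordinates \<open>i\<close> and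
  \<open>j\<close>; the integer \<open>(p + 1) div 2\<close> is an inverse of 2 modulo \<open>p\<close>.\<close>

definition primitive :: "nat \<Rightarrow> nat \<Rightarrow> 'a \<Rightarrow> int" where
  "primitive i j x =
     (if i = j then int ((p + 1) div 2) * (co x (i, i) * (co x (i, i) - 1))
      else if i < j then co x (i, i) * co x (j, j) - co x (i, j)
      else co x (j, i))"

lemma primitive_mult:
  assumes "i = j \<and> i < d \<or> (i, j) \<in> E \<or> (j, i) \<in> E" "x \<in> carrier H" "y \<in> carrier H"
  shows "primitive i j (x \<otimes> y) mod int p
    = (primitive i j x + primitive i j y + co x (i, i) * co y (j, j)) mod int p"
proof -
  have E: "(i, j) \<in> E \<Longrightarrow> i < j \<and> j < d" for i j using E_less[of i j] E_less_d[of i j] by simp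
  consider "i = j" "i < d" | "(i, j) \<in> E" | "(j, i) \<in> E" using assms by blast
  then show ?thesis
  proof cases
    case 1
    obtain m where m: "p = 2 * m + 1" using odd_p by (rule oddE)
    let ?a = "co x (i, i)" and ?b = "co y (i, i)" and ?k = "int ((p + 1) div 2)"
    have k: "2 * ?k = int p + 1" by (simp add: m)
    have "primitive i j (x \<otimes> y) mod int p = (?k * ((?a + ?b) mod int p * ((?a + ?b) mod int p - 1))) mod int p"
      using 1 assms by (simp add: primitive_def co_mult)
    also have "\<dots> = (?k * ((?a + ?b) * (?a + ?b - 1))) mod int p"
      by (intro mod_mult_cong mod_diff_cong refl) simp_all
    also have "?k * ((?a + ?b) * (?a + ?b - 1)) = ?k * (?a * (?a - 1)) + ?k * (?b * (?b - 1)) + (2 * ?k) * (?a * ?b)"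
      by (simp add: algebra_simps)
    also have "\<dots> = ?k * (?a * (?a - 1)) + ?k * (?b * (?b - 1)) + ?a * ?b + int p * (?a * ?b)"
      unfolding k by (simp add: algebra_simps)
    finally show ?thesis using 1 by (simp add: primitive_def)
  next
    case 2
    then have "i < j" "j < d" "i < d" using E[of i j] by auto
    let ?s = "co x (i, i) + co y (i, i)" and ?t = "co x (j, j) + co y (j, j)"
      and ?w = "co x (i, j) + co y (i, j) + co x (j, j) * co y (i, i)"
    have "primitive i j (x \<otimes> y) mod int p = (?s mod int p * (?t mod int p) - ?w mod int p) mod int p"
      using 2 \<open>i < j\<close> \<open>j < d\<close> assms E_B[of "(i, j)"] by (simp add: primitive_def co_mult)
    also have "\<dots> = (?s * ?t - ?w) mod int p"
      by (intro mod_diff_cong mod_mult_cong) simp_all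
    finally show ?thesis using \<open>i < j\<close> by (simp add: primitive_def algebra_simps)
  next
    case 3
    then show ?thesis using E[of j i] assms E_B[of "(j, i)"] by (simp add: primitive_def co_mult)
  qed
qed

text \<open>The Massey product of the coordinates \<open>i\<close>, \<open>j\<close> and
  \<open>l\<close>, with \<open>primitive\<close> supplying the cochains that bound the two cup
  products.\<close>

definition massey :: "nat \<Rightarrow> nat \<Rightarrow> nat \<Rightarrow> 'a \<Rightarrow> 'a \<Rightarrow> int" where
  "massey i j l x y = primitive i j x * co y (l, l) + co x (i, i) * primitive j l y"

text \<open>A cup product for a nonadjacent pair and a Massey product for an edge with a vertex. The
  order of the indices and the sign make the value at the matching pair 1:
  \<open>primitive b a\<close> is 1 at \<open>gen (a, b)\<close>, and \<open>primitive a b\<close>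
  is -1.\<close>

fun basic_cocycle :: "nat \<times> nat + (nat \<times> nat) \<times> nat \<Rightarrow> 'a \<Rightarrow> 'a \<Rightarrow> int" where
  "basic_cocycle (Inl (i, j)) x y = co x (i, i) * co y (j, j)"
| "basic_cocycle (Inr ((a, b), c)) x y = (if c = a then massey b a a x y else - massey a b c x y)"

lemma co_diag_mult:
  "x \<in> carrier H \<Longrightarrow> y \<in> carrier H \<Longrightarrow> co (x \<otimes> y) (i, i) = (co x (i, i) + co y (i, i)) mod int p"
  by (cases "i < d") (simp_all add: co_mult co_outside)

lemma co_diag_mult_mod:
  "x \<in> carrier H \<Longrightarrow> y \<in> carrier H \<Longrightarrow> co (x \<otimes> y) (i, i) mod int p = (co x (i, i) + co y (i, i)) mod int p"
  by (simp add: co_diag_mult)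

lemma mod_cocycle_massey_coordinates:
  assumes "i = j \<and> i < d \<or> (i, j) \<in> E \<or> (j, i) \<in> E" "j = l \<and> j < d \<or> (j, l) \<in> E \<or> (l, j) \<in> E"
  shows "mod_cocycle p H (massey i j l)"
  unfolding massey_def
  by (rule mod_cocycle_massey[where b = "\<lambda>x. co x (j, j)"])
    (simp_all add: co_diag_mult primitive_mult[OF assms(1)] primitive_mult[OF assms(2)])

text \<open>For an edge \<open>(a, b)\<close> and \<open>a < c\<close>, the upward closure of \<open>E\<close> makes \<open>b\<close> and \<open>c\<close> equal or
  adjacent.\<close>

lemma mod_cocycle_basic:
  assumes "\<iota> \<in> index"
  shows "mod_cocycle p H (basic_cocycle \<iota>)"
  using assms
proof (cases rule: index_cases)
  case (nonedge i j)
  show ?thesis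
    unfolding mod_cocycle_def nonedge(1)
  proof (intro ballI)
    fix x y z assume xyz: "x \<in> carrier H" "y \<in> carrier H" "z \<in> carrier H"
    have "(co x (i, i) * co y (j, j) + co z (j, j) * co (x \<otimes> y) (i, i)) mod int p
        = (co x (i, i) * co y (j, j) + co z (j, j) * (co x (i, i) + co y (i, i))) mod int p"
      using xyz by (intro mod_add_cong mod_mult_cong co_diag_mult_mod refl)
    also have "\<dots> = (co y (i, i) * co z (j, j) + co x (i, i) * (co y (j, j) + co z (j, j))) mod int p"
      by (simp add: algebra_simps)
    also have "\<dots> = (co y (i, i) * co z (j, j) + co x (i, i) * co (y \<otimes> z) (j, j)) mod int p"
      using xyz by (intro mod_add_cong mod_mult_cong co_diag_mult_mod[symmetric] refl)
    finally show "(basic_cocycle (Inl (i, j)) x y + basic_cocycle (Inl (i, j)) (x \<otimes> y) z) mod int p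
        = (basic_cocycle (Inl (i, j)) y z + basic_cocycle (Inl (i, j)) x (y \<otimes> z)) mod int p"
      by (simp add: mult.commute)
  qed
next
  case (edge a b c)
  have "b < d" using edge \<delta>_le by simp
  have "b = c \<and> b < d \<or> (b, c) \<in> E \<or> (c, b) \<in> E" if "c \<noteq> a"
    using E_up[OF edge(2), of b c] E_up[OF edge(2), of c b] edge that \<open>b < d\<close> by force
  moreover have "a < d" using edge \<open>b < d\<close> by simp
  ultimately have "c \<noteq> a \<Longrightarrow> mod_cocycle p H (massey a b c)" "mod_cocycle p H (massey b a a)"
    using edge by (auto intro!: mod_cocycle_massey_coordinates)
  moreover have "basic_cocycle \<iota> = (if c = a then massey b a a else (\<lambda>x y. - massey a b c x y))"
    unfolding edge(1) by (auto simp: fun_eq_iff)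
  ultimately show ?thesis by (simp add: mod_cocycle_uminus)
qed

text \<open>Cup products vanish at pairs that involve some \<open>gen e\<close>, whose diagonal
  coordinates are zero; Massey products vanish at pairs of vertices, where \<open>primitive\<close>
  is zero. Between Massey products only the order of the indices separates the cases.\<close>

lemma basic_cocycle_dual:
  assumes "\<iota> \<in> index" "\<kappa> \<in> index"
  shows "basic_cocycle \<iota> (lft \<kappa>) (rgt \<kappa>) - basic_cocycle \<iota> (rgt \<kappa>) (lft \<kappa>) = (if \<iota> = \<kappa> then 1 else 0)"
  using assms(2)
proof (cases rule: index_cases)
  case \<kappa>: (nonedge i j)
  have co: "co (vtx i) b = (if b = (i, i) then 1 else 0)" "co (vtx j) b = (if b = (j, j) then 1 else 0)" for b
    using \<kappa> by (simp_all add: co_gen)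
  have 0: "primitive k l (vtx i) = 0" "primitive k l (vtx j) = 0" for k l
    using \<kappa> by (auto simp: primitive_def co)
  from assms(1) show ?thesis
  proof (cases rule: index_cases)
    case (nonedge i' j')
    then show ?thesis using \<kappa> by (auto simp: co)
  next
    case (edge a b c)
    then show ?thesis by (simp add: \<kappa>(1) massey_def 0)
  qed
next
  case \<kappa>: (edge a b c)
  have ab: "(a, b) \<in> B" using E_B[OF \<kappa>(2)] .
  have co: "co (gen (a, b)) q = (if q = (a, b) then 1 else 0)" "co (vtx c) q = (if q = (c, c) then 1 else 0)" for q
    using \<kappa> ab by (simp_all add: co_gen)
  have pc: "primitive k l (vtx c) = 0" for k l by (auto simp: primitive_def co)
  have pg: "primitive k l (gen (a, b)) = (if (k, l) = (a, b) then -1 else if (l, k) = (a, b) then 1 else 0)" for k l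
    using \<kappa> by (auto simp: primitive_def co)
  from assms(1) show ?thesis
  proof (cases rule: index_cases)
    case (nonedge i' j')
    then show ?thesis using \<kappa> by (auto simp: co)
  next
    case (edge a' b' c')
    have m: "massey k l n (gen (a, b)) (vtx c) = (if n = c then primitive k l (gen (a, b)) else 0)"
        "massey k l n (vtx c) (gen (a, b)) = (if k = c then primitive l n (gen (a, b)) else 0)" for k l n
      using \<kappa>(3) by (auto simp: massey_def pc co)
    have lt: "a < b" "a \<le> c" "a' < b'" "a' \<le> c'" using \<kappa> edge by auto
    show ?thesis
    proof (cases "c' = a'")
      case True
      then show ?thesis unfolding edge(1) \<kappa>(1) using lt by (simp add: m pg)
    next
      case False
      \<comment> \<open>Either of the first two coincidences would give \<open>c < a\<close>; the
        third would reverse the edge \<open>(a', b')\<close>.\<close>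
      have "\<not> (a' = c \<and> (b', c') = (a, b))" "\<not> (a' = c \<and> (c', b') = (a, b))" "(b', a') \<noteq> (a, b)"
        using lt False by auto
      then show ?thesis unfolding edge(1) \<kappa>(1) using lt False by (simp add: m pg)
    qed
  qed
qed

lemma finite_index: "finite index"
proof -
  have "finite {(i, j). i < j \<and> j < d \<and> (i, j) \<notin> E}"
    by (rule finite_subset[of _ "{..<d} \<times> {..<d}"]) auto
  then show ?thesis using finite_E by (simp add: index_def)
qed

text \<open>The commutator values at the index pairs form a complete invariant, and by duality every
  family of \<open>p\<close>-th roots of unity occurs.\<close>

lemma card_schur_multiplier: "card (schur_multiplier H) = p ^ card index"
proof -
  define \<phi> where "\<phi> f = (\<lambda>\<iota>\<in>index. commutator_value f (lft \<iota>) (rgt \<iota>))" for f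
  have p0: "0 < p" using p_gt1 by simp
  have "(f, g) \<in> cohomologous H \<longleftrightarrow> f \<in> cocycles2 H \<and> g \<in> cocycles2 H \<and> \<phi> f = \<phi> g" for f g
    unfolding cohomologous_iff by (auto simp: \<phi>_def fun_eq_iff restrict_def)
  then have "card (schur_multiplier H) = card (\<phi> ` cocycles2 H)"
    unfolding schur_multiplier_def by (rule card_kernel_quotient)
  also have "\<phi> ` cocycles2 H = (index \<rightarrow>\<^sub>E {z. z ^ p = 1})"
  proof (intro equalityI subsetI)
    fix \<tau> assume "\<tau> \<in> \<phi> ` cocycles2 H"
    then show "\<tau> \<in> (index \<rightarrow>\<^sub>E {z. z ^ p = 1})"
      using commutator_value_root by (auto simp: \<phi>_def)
  next
    fix \<tau> :: "nat \<times> nat + (nat \<times> nat) \<times> nat \<Rightarrow> complex" assume \<tau>: "\<tau> \<in> (index \<rightarrow>\<^sub>E {z. z ^ p = 1})"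
    have "\<exists>n. \<tau> \<iota> = unit_root p n" if "\<iota> \<in> index" for \<iota>
    proof -
      have "\<tau> \<iota> \<in> (unit_root p \<circ> int) ` {..<p}"
        using \<tau> that unit_root_bij[OF p0] by (auto simp: bij_betw_def)
      then show ?thesis by auto
    qed
    then obtain n where n: "\<And>\<iota>. \<iota> \<in> index \<Longrightarrow> \<tau> \<iota> = unit_root p (n \<iota>)" by metis
    \<comment> \<open>By duality the coefficient \<open>n \<iota>\<close> becomes the exponent of
      the commutator value at \<open>\<iota>\<close>.\<close>
    let ?P = "\<lambda>x y. \<Sum>\<iota>\<in>index. n \<iota> * basic_cocycle \<iota> x y"
    let ?f = "unit_root_cochain p H ?P"
    have f: "?f \<in> cocycles2 H"
      by (rule unit_root_cochain[OF mod_cocycle_sum p0]) (rule mod_cocycle_basic)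
    have eq: "\<phi> ?f = \<tau>"
    proof (rule extensionalityI[of _ index])
      fix \<kappa> assume \<kappa>: "\<kappa> \<in> index"
      have "\<phi> ?f \<kappa> = unit_root p (?P (lft \<kappa>) (rgt \<kappa>) - ?P (rgt \<kappa>) (lft \<kappa>))"
        using \<kappa> lft_rgt[OF \<kappa>] by (simp add: \<phi>_def commutator_value_def unit_root_cochain_def unit_root_diff)
      also have "?P (lft \<kappa>) (rgt \<kappa>) - ?P (rgt \<kappa>) (lft \<kappa>)
          = (\<Sum>\<iota>\<in>index. n \<iota> * (basic_cocycle \<iota> (lft \<kappa>) (rgt \<kappa>) - basic_cocycle \<iota> (rgt \<kappa>) (lft \<kappa>)))"
        by (simp add: sum_subtractf right_diff_distrib)
      also have "\<dots> = (\<Sum>\<iota>\<in>index. if \<iota> = \<kappa> then n \<iota> else 0)"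
        using \<kappa> by (intro sum.cong) (auto simp: basic_cocycle_dual)
      also have "\<dots> = n \<kappa>" using \<kappa> finite_index by simp
      finally show "\<phi> ?f \<kappa> = \<tau> \<kappa>" using n \<kappa> by simp
    qed (use \<tau> in \<open>auto simp: \<phi>_def PiE_def\<close>)
    show "\<tau> \<in> \<phi> ` cocycles2 H" by (rule image_eqI[where x = ?f]) (fact eq[symmetric], fact f)
  qed
  also have "card \<dots> = p ^ card index"
    using card_roots_unity_eq[OF p0] finite_index by (simp add: card_PiE)
  finally show ?thesis .
qed

end

section \<open>Capability and counting\<close>

text \<open>A direct power of the group of \<open>p\<close>-th roots of unity. The value 1 off
  \<open>I\<close> makes elements that agree on \<open>I\<close> equal.\<close>

definition root_group :: "nat \<Rightarrow> 'i set \<Rightarrow> ('i \<Rightarrow> complex) monoid" where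
  "root_group p I = \<lparr>carrier = {\<alpha>. (\<forall>i\<in>I. \<alpha> i ^ p = 1) \<and> (\<forall>i. i \<notin> I \<longrightarrow> \<alpha> i = 1)},
     monoid.mult = (\<lambda>\<alpha> \<beta> i. \<alpha> i * \<beta> i), one = (\<lambda>_. 1)\<rparr>"

lemma comm_group_root_group:
  assumes "0 < p"
  shows "comm_group (root_group p I)"
proof (rule comm_groupI)
  fix \<alpha> assume \<alpha>: "\<alpha> \<in> carrier (root_group p I)"
  then have "\<alpha> i \<noteq> 0" for i
    using assms by (cases "i \<in> I") (auto simp: root_group_def zero_power)
  then show "\<exists>\<beta>\<in>carrier (root_group p I). \<beta> \<otimes>\<^bsub>root_group p I\<^esub> \<alpha> = \<one>\<^bsub>root_group p I\<^esub>"
    using \<alpha> by (intro bexI[of _ "\<lambda>i. inverse (\<alpha> i)"]) (auto simp: root_group_def power_inverse)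
qed (auto simp: root_group_def power_mult_distrib mult_ac)

lemma finite_root_group:
  assumes "0 < p" "finite I"
  shows "finite (carrier (root_group p I))"
proof (rule finite_subset)
  show "carrier (root_group p I) \<subseteq> (\<lambda>g i. if i \<in> I then g i else 1) ` (I \<rightarrow>\<^sub>E {z. z ^ p = 1})"
  proof
    fix \<alpha> assume "\<alpha> \<in> carrier (root_group p I)"
    then show "\<alpha> \<in> (\<lambda>g i. if i \<in> I then g i else 1) ` (I \<rightarrow>\<^sub>E {z. z ^ p = 1})"
      by (intro image_eqI[where x = "restrict \<alpha> I"]) (auto simp: root_group_def fun_eq_iff)
  qed
  show "finite ((\<lambda>g i. if i \<in> I then g i else 1) ` (I \<rightarrow>\<^sub>E {z :: complex. z ^ p = 1}))"
    using assms by (intro finite_imageI finite_PiE finite_roots_unity) auto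
qed

section \<open>The centre of the extension by roots of unity, and capability\<close>

context shifted_group
begin

text \<open>For a central element the coordinate at a vertex \<open>i\<close> from
  \<open>\<delta>\<close> on is detected by the cup product for \<open>(0, i)\<close> against
  \<open>vtx 0\<close>, and the coordinate at an edge \<open>(i, j)\<close> by the Massey product
  for \<open>((i, j), j)\<close> against \<open>vtx j\<close>.\<close>

lemma center_trivial_if_symmetric:
  assumes z: "z \<in> group_center H"
    and sym: "\<And>\<iota> y. \<iota> \<in> index \<Longrightarrow> y \<in> carrier H \<Longrightarrow>
      basic_cocycle \<iota> z y mod int p = basic_cocycle \<iota> y z mod int p"
  shows "z = \<one>"
proof (rule co_inj)
  have zc: "z \<in> carrier H" and z0: "co z (i, i) = 0" if "i < \<delta>" for i
    using z that by (auto simp: center_H)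
  show zc: "z \<in> carrier H" using z by (auto simp: center_H)
  fix i j
  show "co z (i, j) = co \<one> (i, j)"
  proof (cases "(i, j) \<in> B")
    case True
    then show ?thesis
    proof (cases rule: B_cases)
      case 1
      show ?thesis
      proof (cases "i < \<delta>")
        case False
        then have "Inl (0, i) \<in> index" using 1 \<delta>_ge E_less[of 0 i] by (auto simp: index_simps)
        moreover have "vtx 0 \<in> carrier H" "co (vtx 0) (i, i) = 0" "co (vtx 0) (0, 0) = 1"
          using False 1 \<delta>_ge \<delta>_le by (auto simp: co_gen)
        ultimately show ?thesis using sym[of "Inl (0, i)" "vtx 0"] 1 zc by (simp add: co_one)
      qed (use 1 z0 in \<open>simp add: co_one\<close>)
    next
      case 2
      then have ij: "i < j" "j < \<delta>" "j < d" "i < \<delta>" using E_less[of i j] \<delta>_le by auto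
      have \<iota>: "Inr ((i, j), j) \<in> index" using 2 ij by (simp add: index_simps)
      have v: "vtx j \<in> carrier H" "co (vtx j) (j, j) = 1" "co (vtx j) (i, i) = 0" "co (vtx j) (i, j) = 0"
        using ij by (auto simp: co_gen)
      have "massey i j j z (vtx j) = - co z (i, j)" "massey i j j (vtx j) z = 0"
        using ij z0[of i] z0[of j] v by (simp_all add: massey_def primitive_def)
      then show ?thesis using sym[OF \<iota> v(1)] ij zc by (simp add: co_one)
    qed
  qed (use zc in \<open>simp add: co_outside co_one\<close>)
qed simp

lemma basic_cocycle_one:
  assumes "\<iota> \<in> index"
  shows "basic_cocycle \<iota> \<one> y = 0" "basic_cocycle \<iota> y \<one> = 0"
proof -
  have "primitive i j \<one> = 0" for i j by (simp add: primitive_def co_one)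
  then show "basic_cocycle \<iota> \<one> y = 0" "basic_cocycle \<iota> y \<one> = 0"
    using assms by (auto simp: massey_def co_one elim!: index_cases)
qed

lemma capable_H: "capable H"
proof -
  have p0: "0 < p" using p_gt1 by simp
  \<comment> \<open>All basic cocycles are used at once, one coordinate for each index, so commuting
    in the extension tests the symmetry of every one of them.\<close>
  define f where "f x y = (\<lambda>\<iota>. if \<iota> \<in> index then unit_root p (basic_cocycle \<iota> x y) else 1)" for x y
  let ?A = "root_group p index"
  interpret A: comm_group ?A using p0 by (rule comm_group_root_group)
  have fA: "f x y \<in> carrier ?A" for x y
    using unit_root_power[OF p0] by (auto simp: root_group_def f_def)
  have f1: "f \<one> y = \<one>\<^bsub>?A\<^esub>" "f y \<one> = \<one>\<^bsub>?A\<^esub>" for y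
    by (auto simp: f_def root_group_def basic_cocycle_one)
  interpret X: central_extension ?A H f
  proof unfold_locales
    fix x y z assume "x \<in> carrier H" "y \<in> carrier H" "z \<in> carrier H"
    then show "f x y \<otimes>\<^bsub>?A\<^esub> f (x \<otimes> y) z = f y z \<otimes>\<^bsub>?A\<^esub> f x (y \<otimes> z)"
      using unit_root_cocycle[OF mod_cocycle_basic p0] by (auto simp: f_def root_group_def fun_eq_iff)
  qed (simp_all add: fA f1)
  let ?K = "central_ext ?A H f"
  have center: "group_center ?K = carrier ?A \<times> {\<one>}"
  proof (intro equalityI subsetI)
    fix u assume u: "u \<in> group_center ?K"
    obtain a z where uz: "u = (a, z)" by force
    have az: "a \<in> carrier ?A" "z \<in> carrier H" using u by (auto simp: group_center_def X.Ext_carrier uz)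
    have c: "z \<otimes> y = y \<otimes> z \<and> f z y = f y z" if "y \<in> carrier H" for y
    proof -
      have "(\<one>\<^bsub>?A\<^esub>, y) \<in> carrier ?K" using that by (simp add: X.Ext_carrier)
      then have "(a, z) \<otimes>\<^bsub>?K\<^esub> (\<one>\<^bsub>?A\<^esub>, y) = (\<one>\<^bsub>?A\<^esub>, y) \<otimes>\<^bsub>?K\<^esub> (a, z)"
        using u by (simp only: group_center_def uz mem_Collect_eq)
      then show ?thesis using X.Ext_commute_iff[OF az(1) A.one_closed az(2) that] by simp
    qed
    have "z = \<one>"
    proof (rule center_trivial_if_symmetric)
      show "z \<in> group_center H" using c az by (simp add: group_center_def)
      fix \<iota> y assume "\<iota> \<in> index" "y \<in> carrier H"
      then show "basic_cocycle \<iota> z y mod int p = basic_cocycle \<iota> y z mod int p"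
        using fun_cong[OF conjunct2[OF c[of y]], of \<iota>] by (simp add: f_def unit_root_eq_iff[OF p0])
    qed
    then show "u \<in> carrier ?A \<times> {\<one>}" using az uz by simp
  next
    fix u assume "u \<in> carrier ?A \<times> {\<one>}"
    then obtain a where u: "u = (a, \<one>)" "a \<in> carrier ?A" by auto
    have "(a, \<one>) \<otimes>\<^bsub>?K\<^esub> v = v \<otimes>\<^bsub>?K\<^esub> (a, \<one>)" if vK: "v \<in> carrier ?K" for v
    proof -
      obtain b y where v: "v = (b, y)" "b \<in> carrier ?A" "y \<in> carrier H"
        using vK by (auto simp: X.Ext_carrier)
      then show ?thesis using X.Ext_commute_iff[OF u(2) v(2) one_closed v(3)] f1 by simp
    qed
    then show "u \<in> group_center ?K" using u by (simp add: group_center_def X.Ext_carrier)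
  qed
  show ?thesis
  proof (rule capableI[OF X.snd_hom])
    show "finite (carrier ?K)"
      using finite_root_group[OF p0 finite_index] finite_H by (simp add: X.Ext_carrier)
    show "snd ` carrier ?K = carrier H"
      using A.one_closed by (force simp: X.Ext_carrier image_iff)
    show "kernel ?K H snd = group_center ?K"
      unfolding center by (auto simp: kernel_def X.Ext_carrier)
  qed
qed

end

section \<open>Counting the edges and the index pairs\<close>

definition upper_triangle :: "nat \<Rightarrow> (nat \<times> nat) set" where
  "upper_triangle n = {(a, b). a < b \<and> b < n}"

text \<open>For \<open>t \<le> r < \<delta>\<close> the complement among the increasing pairs below
  \<open>\<delta>\<close> is an initial segment of the colexicographic order.\<close>

definition shifted_edges :: "nat \<Rightarrow> nat \<Rightarrow> nat \<Rightarrow> (nat \<times> nat) set" where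
  "shifted_edges \<delta> r t = {(a, b). a < b \<and> b < \<delta> \<and> (r < b \<or> b = r \<and> t \<le> a)}"

lemma finite_upper_triangle: "finite (upper_triangle n)"
  by (rule finite_subset[of _ "{..<n} \<times> {..<n}"]) (auto simp: upper_triangle_def)

lemma sum_upper_triangle_Suc:
  "sum f (upper_triangle (Suc n)) = sum f (upper_triangle n) + (\<Sum>a<n. f (a, n))"
  for f :: "nat \<times> nat \<Rightarrow> nat"
proof -
  have "upper_triangle (Suc n) = upper_triangle n \<union> (\<lambda>a. (a, n)) ` {..<n}"
    by (auto simp: upper_triangle_def)
  moreover have "sum f ((\<lambda>a. (a, n)) ` {..<n}) = (\<Sum>a<n. f (a, n))"
    by (subst sum.reindex) (auto simp: inj_on_def)
  moreover have "upper_triangle n \<inter> (\<lambda>a. (a, n)) ` {..<n} = {}" by (auto simp: upper_triangle_def)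
  ultimately show ?thesis using finite_upper_triangle by (simp add: sum.union_disjoint)
qed

lemma sum_lessThan_choose: "(\<Sum>a<n. a) = n choose 2" for n :: nat
  by (induction n) (simp_all add: numeral_2_eq_2)

lemma card_upper_triangle: "card (upper_triangle n) = n choose 2"
proof -
  have "(\<Sum>e\<in>upper_triangle n. 1) = n choose 2"
  proof (induction n)
    case (Suc n)
    then show ?case unfolding sum_upper_triangle_Suc by (simp add: numeral_2_eq_2)
  qed (simp add: upper_triangle_def)
  then show ?thesis by simp
qed

text \<open>The pairs with larger entry \<open>b\<close> contribute \<open>b choose 2\<close>, and
  these sum to \<open>n choose 3\<close> by Pascal's rule.\<close>

lemma sum_fst_upper_triangle: "sum fst (upper_triangle n) = n choose 3"
proof (induction n)
  case (Suc n)
  then show ?case unfolding sum_upper_triangle_Suc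
    by (simp add: sum_lessThan_choose numeral_3_eq_3 numeral_2_eq_2)
qed (simp add: upper_triangle_def)

text \<open>With \<open>f\<close> constantly 1 this counts the edges; with \<open>f = fst\<close> it
  produces the binomials of the exponent.\<close>

lemma sum_shifted_edges:
  fixes f :: "nat \<times> nat \<Rightarrow> nat"
  assumes "r < \<delta>" "t \<le> r"
  shows "sum f (upper_triangle \<delta>) = sum f (shifted_edges \<delta> r t) + sum f (upper_triangle r) + (\<Sum>a<t. f (a, r))"
proof -
  let ?R = "(\<lambda>a. (a, r)) ` {..<t}"
  have eq: "upper_triangle \<delta> = (shifted_edges \<delta> r t \<union> upper_triangle r) \<union> ?R"
    using assms by (auto simp: upper_triangle_def shifted_edges_def)
  have fin: "finite (shifted_edges \<delta> r t)"
    by (rule finite_subset[OF _ finite_upper_triangle[of \<delta>]]) (auto simp: upper_triangle_def shifted_edges_def)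
  have R: "sum f ?R = (\<Sum>a<t. f (a, r))" by (subst sum.reindex) (auto simp: inj_on_def)
  have "(shifted_edges \<delta> r t \<union> upper_triangle r) \<inter> ?R = {}" "shifted_edges \<delta> r t \<inter> upper_triangle r = {}"
    by (auto simp: upper_triangle_def shifted_edges_def)
  then show ?thesis
    unfolding eq using fin finite_upper_triangle by (simp add: sum.union_disjoint R)
qed

lemma (in shifted_graph) shifted_group_exists:
  obtains H :: "nat monoid" and co where "shifted_group p d \<delta> E H co"
proof -
  obtain \<phi> :: "(nat \<times> nat \<Rightarrow> int) \<Rightarrow> nat" where \<phi>: "inj_on \<phi> (carrier T)"
    using finite_imp_inj_to_nat_seg card_T by blast
  interpret T: group T by (rule group_T)
  have "inv_into (carrier T) \<phi> \<in> iso (image_group \<phi> T) T"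
    by (rule T.iso_set_sym[OF inj_imp_image_group_iso[OF \<phi>]])
  then have "shifted_group p d \<delta> E (image_group \<phi> T) (inv_into (carrier T) \<phi>)"
    using T.inj_imp_image_group_is_group[OF \<phi>] shifted_graph_axioms
    by (simp add: shifted_group_def shifted_group_axioms_def)
  then show thesis by (rule that)
qed

text \<open>The nonadjacent pairs number \<open>d choose 2\<close> less \<open>card E\<close>, and
  each edge \<open>e\<close> admits \<open>\<delta> - fst e\<close> vertices.\<close>

lemma (in shifted_group) card_index:
  "int (card index) + int (sum fst E) + int (card E) = int (d choose 2) + int (card E) * int \<delta>"
proof -
  have sub: "E \<subseteq> upper_triangle d" using E_less E_less_d by (auto simp: upper_triangle_def)
  have "{(i, j). i < j \<and> j < d \<and> (i, j) \<notin> E} = upper_triangle d - E" by (auto simp: upper_triangle_def)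
  then have "card index = card (upper_triangle d - E) + card (SIGMA e:E. {fst e..<\<delta>})"
    unfolding index_def using finite_E finite_upper_triangle by (simp add: card_Plus)
  also have "card (SIGMA e:E. {fst e..<\<delta>}) = (\<Sum>e\<in>E. \<delta> - fst e)"
    using finite_E by simp
  finally have "int (card index) = int (card (upper_triangle d - E)) + (\<Sum>e\<in>E. int (\<delta> - fst e))" by simp
  also have "(\<Sum>e\<in>E. int (\<delta> - fst e)) = (\<Sum>e\<in>E. int \<delta> - int (fst e))"
    using E_less by (intro sum.cong) (force simp: of_nat_diff)+
  also have "\<dots> = int (card E) * int \<delta> - int (sum fst E)" by (simp add: sum_subtractf)
  also have "int (card (upper_triangle d - E)) = int (d choose 2) - int (card E)"
    using card_mono[OF finite_upper_triangle sub] card_Diff_subset[OF finite_E sub]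
    by (simp add: card_upper_triangle of_nat_diff)
  finally show ?thesis by simp
qed

lemma two_times_choose_two: "2 * int (n choose 2) = int n * (int n - 1)"
  by (induction n) (simp_all add: numeral_2_eq_2 algebra_simps)

theorem theorem4p3:
  fixes p d \<delta> k k' r t :: nat
  assumes "Factorial_Ring.prime p" and "odd p"
    and "2 \<le> \<delta>"
    and "k = k'" and "\<delta> - 1 \<le> k'" and "\<delta> \<le> d" and "k \<le> \<delta> choose 2"
    and "int (\<delta> choose 2) - int k' = int (r choose 2) + int t" and "t < r"
  shows "\<exists>H :: nat monoid. group H \<and> finite (carrier H) \<and> capable H
     \<and> nilpotent_class_two H \<and> group_exponent H = p
     \<and> min_gens H = d
     \<and> min_gens (H Mod group_center H) = \<delta>
     \<and> min_gens (H\<lparr>carrier := commutator_subgroup H\<rparr>) = k'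
     \<and> card (commutator_subgroup H) = p ^ k
     \<and> card (carrier H) = p ^ (d + k)
     \<and> (\<exists>m :: nat. card (schur_multiplier H) = p ^ m
          \<and> 2 * int m = (int d - 1) * (int (d + k) + int k) - 2 * int k * (int d - int \<delta>)
               - 2 * int (\<delta> choose 3) + 2 * int (r choose 3) + 2 * int (t choose 2))"
proof -
  let ?E = "shifted_edges \<delta> r t"
  obtain n where n: "\<delta> = Suc n" "0 < n" using assms(3) by (cases \<delta>) auto
  have choose: "\<delta> choose 2 = (n choose 2) + n" by (simp add: n numeral_2_eq_2)
  \<comment> \<open>At least \<open>n = \<delta> - 1\<close> edges are required, so the commuting
    pairs are no more than the pairs below \<open>n\<close>. This bounds \<open>r\<close> and keeps
    the edge \<open>(0, n)\<close> available.\<close>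
  have le: "(r choose 2) + t \<le> n choose 2" using assms(5,8) n choose by simp
  have r: "r \<le> n"
  proof (rule ccontr)
    assume "\<not> r \<le> n"
    then have "\<delta> choose 2 \<le> r choose 2" by (intro binomial_right_mono) (simp add: n)
    then show False using le choose n by simp
  qed
  \<comment> \<open>If \<open>r = n\<close>, all pairs below \<open>n\<close> commute already and
    none is left for \<open>t\<close>; then every pair \<open>(a, n)\<close> with
    \<open>a < n\<close> is an edge.\<close>
  then have top: "n = r \<Longrightarrow> t = 0" using le by simp
  have "shifted_graph p d \<delta> ?E"
  proof
    show "(0, \<delta> - 1) \<in> ?E" using r top n by (auto simp: shifted_edges_def)
  qed (use assms in \<open>auto simp: shifted_edges_def\<close>)
  then obtain H :: "nat monoid" and co where "shifted_group p d \<delta> ?E H co"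
    using shifted_graph.shifted_group_exists by blast
  then interpret shifted_group p d \<delta> ?E H co .
  have "(\<delta> choose 2) = card ?E + (r choose 2) + t"
    using sum_shifted_edges[of r \<delta> t "\<lambda>_. 1"] r n assms(9) by (simp add: card_upper_triangle)
  then have card_E: "card ?E = k" using assms(4,8) by simp
  have "(\<delta> choose 3) = sum fst ?E + (r choose 3) + (t choose 2)"
    using sum_shifted_edges[of r \<delta> t fst] r n assms(9)
    by (simp add: sum_fst_upper_triangle sum_lessThan_choose)
  then have "2 * int (card index) = (int d - 1) * (int (d + k) + int k) - 2 * int k * (int d - int \<delta>)
      - 2 * int (\<delta> choose 3) + 2 * int (r choose 3) + 2 * int (t choose 2)"
    using card_index two_times_choose_two[of d] by (simp add: card_E algebra_simps)
  then show ?thesis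
    using is_group finite_H capable_H nilpotent_H group_exponent_H min_gens_H min_gens_central_quotient
      min_gens_commutator card_commutator card_H card_schur_multiplier assms(4)
    unfolding card_E by blast
qed

end
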